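(* Assume $|V|\ge 3$. For every number of agents $n$ and every $f$ with $0\le f\le n-2$, there exists a deterministic $(2,f)$-resilient consensus protocol (the paper's protocol Alg-NewEpoch).
   Context: Model. There are $n$ agents $\Pi=\{1,\dots,n\}$ proceeding in synchronous rounds $1,2,\dots$. In each round every agent first chooses, for each agent $j$, a message to send to $j$ or no message; then it receives the messages sent to it in that round; then it updates its local state; agents cannot alter this round structure. Channels are reliable. A failure pattern $F$ is a subset of $\{(i,j,r)\}$, where $(i,j,r)\in F$ means $i$'s round-$r$ message to $j$ would be delivered if sent; if $(i,j,r)\notin F$ then $(i,j',r')\notin F$ for all $j'$ and $r'>r$. Agent $i$ is correct if $(i,j,r)\in F$ for all $j,r$, faulty otherwise. In a system with at most $f$ crash failures only failure patterns with at most $f$ faulty agents occur. $V$ is a finite set of proposal values; the private type $\theta_i$ is a strict total order on $V$. A deterministic strategy $s_i$ maps $\theta_i$ to a function from (round $r$, messages received in rounds $1..r$) to (messages for round $r+1$, a decision in $V\cup\{\top\}$ or $\bot$ = no decision), $\top\notin V$; each agent decides at most once. A protocol is a profile $\vec s$; the run $R(F,\vec\theta,\vec s)$ is determined. Legal profile: for every admissible $F$ and every $\vec\theta$: Termination (every correct agent eventually decides), Uniform Agreement (no two agents, correct or not, decide differently), Validity (any decision is an element of $V$ that is the most preferred value of some agent). Utility of $i$: $0$ if $i$ crashes in $F$; if consensus holds with decision $d$, a positive value strictly increasing in $i$'s preference for $d$; $-\infty$ if consensus is violated. Colluders $C$ may deviate arbitrarily (e.g. send different messages, pretend to have received messages,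 pretend to crash, decide differently), with strategies depending on all colluders' types. $C$ can strategically manipulate a legal $\vec s$ if there is $\vec s'_C$ with (a) $(\vec s_{-C},\vec s'_C)$ legal, and (b) some admissible $F$ and some $\vec\theta$ in which all members of $C$ have the same most preferred value, such that some $i\in C$ has strictly higher utility under $(\vec s_{-C},\vec s'_C)$ than under $\vec s$. A $(c,f)$-resilient consensus protocol is a legal profile that no group of size at most $c$ can strategically manipulate, in a system with at most $f$ crash failures. *)

theory Defs
  imports Main "HOL-Library.Extended_Real"
begin

(* Agents are 0,...,n-1 (the paper's 1..n shifted by one).
   Rounds are numbered 1,2,...; "time r" (r = 0,1,...) is the end of round r
   (time 0 = before round 1).  Messages are natural numbers (any countable
   message alphabet can be encoded). *)

(* A type theta_i is a strict total order on V (the universe of 'v);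
   (x,y) \<in> theta means x is strictly preferred to y. *)
definition is_type :: "('v \<times> 'v) set \<Rightarrow> bool" where
  "is_type th \<longleftrightarrow> strict_linear_order_on UNIV th"

definition most_pref :: "('v \<times> 'v) set \<Rightarrow> 'v \<Rightarrow> bool" where
  "most_pref th v \<longleftrightarrow> (\<forall>w. w \<noteq> v \<longrightarrow> (v, w) \<in> th)"

(* decisions: a value of V, or Top (not in V); None in an output = no decision (\<bottom>) *)
datatype 'v dec = Val 'v | Top

(* local history: round \<Rightarrow> sender \<Rightarrow> message received (None = nothing received) *)
type_synonym hist = "nat \<Rightarrow> nat \<Rightarrow> nat option"
(* output at time r: messages for round r+1 (recipient \<Rightarrow> message or none), decision *)
type_synonym 'v out = "(nat \<Rightarrow> nat option) \<times> 'v dec option"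
(* instantiated behaviours: agent \<Rightarrow> time r \<Rightarrow> history of rounds 1..r \<Rightarrow> output *)
type_synonym 'v behav = "nat \<Rightarrow> nat \<Rightarrow> hist \<Rightarrow> 'v out"
(* a (deterministic) protocol: s i theta_i r h *)
type_synonym 'v protocol = "nat \<Rightarrow> ('v \<times> 'v) set \<Rightarrow> nat \<Rightarrow> hist \<Rightarrow> 'v out"
(* joint profile: agent \<Rightarrow> full type profile \<Rightarrow> time \<Rightarrow> history \<Rightarrow> output *)
type_synonym 'v jprofile = "nat \<Rightarrow> (nat \<Rightarrow> ('v \<times> 'v) set) \<Rightarrow> nat \<Rightarrow> hist \<Rightarrow> 'v out"
(* failure pattern: (i,j,r) \<in> F iff i's round-r message to j would be delivered *)
type_synonym fpattern = "(nat \<times> nat \<times> nat) set"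

definition fp_ok :: "nat \<Rightarrow> fpattern \<Rightarrow> bool" where
  "fp_ok n F \<longleftrightarrow> F \<subseteq> {(i,j,r). i < n \<and> j < n \<and> 1 \<le> r} \<and>
     (\<forall>i j r j' r'. i < n \<and> j < n \<and> 1 \<le> r \<and> (i,j,r) \<notin> F \<and> j' < n \<and> r < r'
        \<longrightarrow> (i,j',r') \<notin> F)"

definition correct :: "nat \<Rightarrow> fpattern \<Rightarrow> nat \<Rightarrow> bool" where
  "correct n F i \<longleftrightarrow> (\<forall>j<n. \<forall>r\<ge>1. (i,j,r) \<in> F)"

definition admissible :: "nat \<Rightarrow> nat \<Rightarrow> fpattern \<Rightarrow> bool" where
  "admissible n f F \<longleftrightarrow> fp_ok n F \<and> card {i. i < n \<and> \<not> correct n F i} \<le> f"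

definition alive :: "nat \<Rightarrow> fpattern \<Rightarrow> nat \<Rightarrow> nat \<Rightarrow> bool" where
  "alive n F i r \<longleftrightarrow> (\<forall>j<n. \<forall>r'. 1 \<le> r' \<and> r' \<le> r \<longrightarrow> (i,j,r') \<in> F)"

fun hist_at :: "nat \<Rightarrow> fpattern \<Rightarrow> 'v behav \<Rightarrow> nat \<Rightarrow> nat \<Rightarrow> hist" where
  "hist_at n F Q 0 i = (\<lambda>_ _. None)"
| "hist_at n F Q (Suc r) i =
     (hist_at n F Q r i)(Suc r := (\<lambda>j. if j < n \<and> (j, i, Suc r) \<in> F
                                         then fst (Q j r (hist_at n F Q r j)) i else None))"

definition dec_out :: "nat \<Rightarrow> fpattern \<Rightarrow> 'v behav \<Rightarrow> nat \<Rightarrow> nat \<Rightarrow> 'v dec option" where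
  "dec_out n F Q i r = snd (Q i r (hist_at n F Q r i))"

definition decides_at :: "nat \<Rightarrow> fpattern \<Rightarrow> 'v behav \<Rightarrow> nat \<Rightarrow> nat \<Rightarrow> bool" where
  "decides_at n F Q i r \<longleftrightarrow> alive n F i r \<and> dec_out n F Q i r \<noteq> None"

(* an agent decides at most once: its decision is its first (pre-crash) decision output *)
definition decision :: "nat \<Rightarrow> fpattern \<Rightarrow> 'v behav \<Rightarrow> nat \<Rightarrow> 'v dec option" where
  "decision n F Q i =
     (if \<exists>r. decides_at n F Q i r then dec_out n F Q i (LEAST r. decides_at n F Q i r) else None)"

definition types_ok :: "nat \<Rightarrow> (nat \<Rightarrow> ('v \<times> 'v) set) \<Rightarrow> bool" where
  "types_ok n th \<longleftrightarrow> (\<forall>i<n. is_type (th i))"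

definition consensus_run :: "nat \<Rightarrow> fpattern \<Rightarrow> (nat \<Rightarrow> ('v \<times> 'v) set) \<Rightarrow> 'v behav \<Rightarrow> bool" where
  "consensus_run n F th Q \<longleftrightarrow>
     (\<forall>i<n. correct n F i \<longrightarrow> decision n F Q i \<noteq> None) \<and>
     (\<forall>i<n. \<forall>j<n. \<forall>a b. decision n F Q i = Some a \<longrightarrow> decision n F Q j = Some b \<longrightarrow> a = b) \<and>
     (\<forall>i<n. \<forall>d. decision n F Q i = Some d \<longrightarrow> (\<exists>v. d = Val v \<and> (\<exists>j<n. most_pref (th j) v)))"

definition legal :: "nat \<Rightarrow> nat \<Rightarrow> 'v jprofile \<Rightarrow> bool" where
  "legal n f P \<longleftrightarrow> (\<forall>F th. admissible n f F \<and> types_ok n th \<longrightarrow> consensus_run n F th (\<lambda>i. P i th))"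

definition honest :: "'v protocol \<Rightarrow> 'v jprofile" where
  "honest s = (\<lambda>i th. s i (th i))"

definition deviate :: "'v protocol \<Rightarrow> nat set \<Rightarrow> 'v jprofile \<Rightarrow> 'v jprofile" where
  "deviate s C s' = (\<lambda>i th. if i \<in> C then s' i th else s i (th i))"

definition valid_util :: "(nat \<Rightarrow> ('v \<times> 'v) set \<Rightarrow> 'v \<Rightarrow> real) \<Rightarrow> bool" where
  "valid_util u \<longleftrightarrow> (\<forall>i th x y. is_type th \<longrightarrow>
      0 < u i th x \<and> ((x, y) \<in> th \<longrightarrow> u i th y < u i th x))"

definition utility :: "(nat \<Rightarrow> ('v \<times> 'v) set \<Rightarrow> 'v \<Rightarrow> real) \<Rightarrow> nat \<Rightarrow> fpattern
     \<Rightarrow> (nat \<Rightarrow> ('v \<times> 'v) set) \<Rightarrow> 'v jprofile \<Rightarrow> nat \<Rightarrow> ereal" where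
  "utility u n F th P i =
     (if \<not> correct n F i then 0
      else if consensus_run n F th (\<lambda>j. P j th)
        then (case decision n F (\<lambda>j. P j th) i of Some (Val d) \<Rightarrow> ereal (u i (th i) d) | _ \<Rightarrow> -\<infinity>)
      else -\<infinity>)"

definition can_manipulate :: "(nat \<Rightarrow> ('v \<times> 'v) set \<Rightarrow> 'v \<Rightarrow> real) \<Rightarrow> nat \<Rightarrow> nat
     \<Rightarrow> 'v protocol \<Rightarrow> nat set \<Rightarrow> bool" where
  "can_manipulate u n f s C \<longleftrightarrow>
     (\<exists>s' :: 'v jprofile.
        (\<forall>i\<in>C. \<forall>th th'. (\<forall>j\<in>C. th j = th' j) \<longrightarrow> s' i th = s' i th') \<and>
        legal n f (deviate s C s') \<and>
        (\<exists>F th. admissible n f F \<and> types_ok n th \<and>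
           (\<exists>v. \<forall>i\<in>C. most_pref (th i) v) \<and>
           (\<exists>i\<in>C. utility u n F th (honest s) i < utility u n F th (deviate s C s') i)))"

definition resilient_consensus :: "nat \<Rightarrow> nat \<Rightarrow> nat \<Rightarrow> 'v protocol \<Rightarrow> bool" where
  "resilient_consensus n c f s \<longleftrightarrow>
     legal n f (honest s) \<and>
     (\<forall>u. valid_util u \<longrightarrow>
        (\<forall>C. C \<subseteq> {..<n} \<and> card C \<le> c \<longrightarrow> \<not> can_manipulate u n f s C))"

end

theory Submission
  imports Defs "HOL-Library.Countable"
begin

text \<open>
  Agents \<open>0, 1, 2, \<dots>\<close> coordinate successive epochs. In epoch \<open>e\<close> all agents ping each other, report
  to \<open>e\<close> whose pings were missing, and \<open>e\<close> broadcasts its favourite value together with all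
  reports; \<open>e\<close> decides at once if the broadcast is complete. The others flood for \<open>f + 1\<close> rounds
  whether somebody missed the broadcast, and only if nobody did they decide as well; otherwise
  the next epoch starts. So the deciding coordinator is a function of the failure pattern alone.

  An agent that detects a lie decides \<open>Top\<close>, and since a deviation has to be legal under every
  failure pattern and all types, it suffices that each lie can be detected in some run that looks
  the same to the liar. Hiding a message or inventing one in the name of a live agent is exposed
  if that agent is correct; feigning a crash is exposed if \<open>f\<close> others crash. The delicate lie is
  to claim the receipt of a broadcast of the crashed coordinator. It requires a guess of all reports.
  These depend on one further crash during the pings as long as fewer than \<open>f\<close> crashes are
  known; once only the crash of the coordinator is left, the reports contain favourite values,
  which cannot have been leaked earlier since no epoch with such reports could fail without
  exceeding \<open>f\<close> crashes. If the coordinator is honest, its own favourite value is the secret.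
\<close>

section \<open>Types and runs\<close>

text \<open>To expose a lie in a run that looks the same to the liar, the honest agents of that run
  must be predictable up to the lie. So conformity of the colluders is proved round by round:
  \<open>exact T\<close> collects it up to round \<open>T\<close>, \<open>sync\<close> turns it into
  a description of the honest agents in terms of the failure pattern, and this description serves to
  expose a lie in round \<open>T + 1\<close>. An alarm has an effect only on an agent that has yet
  to decide; each modified pattern therefore preserves the liar's view, makes the observer correct
  and stays within \<open>f\<close> failures. What is enforced is the presence of messages and
  whether a status is \<open>0\<close>; this already determines which epoch succeeds. If its
  coordinator is a colluder, the protocol itself yields the common favourite of the colluders and
  there is nothing to gain. Otherwise the coordinator proposes its own favourite, and uniform
  agreement imposes this value on the colluders.\<close>

definition top_of :: "('v \<times> 'v) set \<Rightarrow> 'v" where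
  "top_of \<theta> = (SOME v. most_pref \<theta> v)"

lemma most_pref_unique:
  assumes "is_type \<theta>" "most_pref \<theta> v" "most_pref \<theta> w"
  shows "v = w"
  using assms unfolding is_type_def most_pref_def strict_linear_order_on_def irrefl_def trans_def by metis

lemma ex_most_pref:
  fixes \<theta> :: "('v::finite \<times> 'v) set"
  assumes "is_type \<theta>"
  shows "\<exists>v. most_pref \<theta> v"
proof -
  have tr: "trans \<theta>" and ir: "irrefl \<theta>" and tot: "total_on UNIV \<theta>"
    using assms unfolding is_type_def strict_linear_order_on_def by auto
  have "\<theta>\<^sup>+ = \<theta>" using tr by simp
  hence "acyclic \<theta>" using ir unfolding acyclic_def irrefl_def by simp
  hence "wf \<theta>" by (rule finite_acyclic_wf[rotated]) simp
  then obtain v where "\<And>y. (y, v) \<in> \<theta> \<Longrightarrow> y \<notin> UNIV"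
    using wfE_min[of \<theta> undefined UNIV] by blast
  hence "most_pref \<theta> v" unfolding most_pref_def using tot unfolding total_on_def by blast
  thus ?thesis by blast
qed

lemma most_pref_iff_top_of:
  fixes \<theta> :: "('v::finite \<times> 'v) set"
  assumes "is_type \<theta>"
  shows "most_pref \<theta> v \<longleftrightarrow> v = top_of \<theta>"
  using someI_ex[OF ex_most_pref[OF assms]] most_pref_unique[OF assms] unfolding top_of_def by blast

text \<open>Provides the second run of the secrecy arguments: one agent gets a type with another
  favourite, and a colluder that cannot see the change would have to guess.\<close>

lemma ex_type_other_top:
  fixes a :: "'v::finite"
  assumes "card (UNIV :: 'v set) \<ge> 2"
  shows "\<exists>\<theta>. is_type \<theta> \<and> top_of \<theta> \<noteq> a"
proof -
  have "card (UNIV - {a}) > 0" using assms by (simp add: card_Diff_singleton)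
  then obtain b :: 'v where ba: "b \<noteq> a" by (metis Diff_iff UNIV_I all_not_in_conv card.empty less_irrefl singletonI)
  define g :: "'v \<Rightarrow> nat" where "g = (\<lambda>x. if x = b then 0 else Suc (to_nat x))"
  have inj: "g x = g y \<Longrightarrow> x = y" for x y unfolding g_def by (auto split: if_splits)
  define \<theta> where "\<theta> = {(x, y). g x < g y}"
  have ty: "is_type \<theta>"
    unfolding is_type_def strict_linear_order_on_def \<theta>_def trans_def irrefl_def total_on_def
    using inj by (auto simp: less_le) 
  have "most_pref \<theta> b" unfolding most_pref_def \<theta>_def g_def by auto
  thus ?thesis using ty ba most_pref_iff_top_of by blast
qed

lemma fp_okD:
  assumes "fp_ok n F" "(i, j, r) \<in> F"
  shows "i < n" "j < n" "1 \<le> r" "alive n F i (r - 1)"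
proof -
  show a: "i < n" "j < n" "1 \<le> r" using assms unfolding fp_ok_def by auto
  show "alive n F i (r - 1)" unfolding alive_def
  proof (intro allI impI)
    fix j' r' assume "j' < n" "1 \<le> r' \<and> r' \<le> r - 1"
    thus "(i, j', r') \<in> F" using assms a unfolding fp_ok_def
      by (metis One_nat_def Suc_pred diff_less le_neq_implies_less less_le_trans less_one not_less zero_less_one linorder_not_le)
  qed
qed

lemma fp_okI:
  assumes "\<And>i j r. (i, j, r) \<in> F \<Longrightarrow> i < n \<and> j < n \<and> 1 \<le> r \<and> alive n F i (r - 1)"
  shows "fp_ok n F"
  unfolding fp_ok_def
proof (intro conjI allI impI subsetI)
  fix x assume "x \<in> F" thus "x \<in> {(i, j, r). i < n \<and> j < n \<and> 1 \<le> r}" using assms by (cases x) auto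
next
  fix i j r j' r' assume a: "i < n \<and> j < n \<and> 1 \<le> r \<and> (i, j, r) \<notin> F \<and> j' < n \<and> r < r'"
  show "(i, j', r') \<notin> F"
  proof
    assume "(i, j', r') \<in> F"
    hence "alive n F i (r' - 1)" using assms by blast
    thus False using a unfolding alive_def by auto
  qed
qed

lemma aliveD: "alive n F i r \<Longrightarrow> j < n \<Longrightarrow> 1 \<le> t \<Longrightarrow> t \<le> r \<Longrightarrow> (i, j, t) \<in> F"
  unfolding alive_def by blast

lemma alive_mono: "alive n F i r \<Longrightarrow> r' \<le> r \<Longrightarrow> alive n F i r'"
  unfolding alive_def by auto

lemma alive_extend: "alive n F i r \<Longrightarrow> (\<And>j. j < n \<Longrightarrow> (i, j, Suc r) \<in> F) \<Longrightarrow> alive n F i (Suc r)"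
  unfolding alive_def by (auto simp: le_Suc_eq)

lemma alive_cong:
  assumes "\<And>j t. j < n \<Longrightarrow> 1 \<le> t \<Longrightarrow> t \<le> r \<Longrightarrow> (i, j, t) \<in> F \<longleftrightarrow> (i, j, t) \<in> F'"
  shows "alive n F i r \<longleftrightarrow> alive n F' i r"
  using assms unfolding alive_def by auto

lemma correct_iff_alive: "correct n F i \<longleftrightarrow> (\<forall>r. alive n F i r)"
  unfolding correct_def alive_def by auto

definition faulty :: "nat \<Rightarrow> fpattern \<Rightarrow> nat set" where
  "faulty n F = {i. i < n \<and> \<not> correct n F i}"

lemma finite_faulty [simp]: "finite (faulty n F)"
  unfolding faulty_def by simp

lemma admissible_iff: "admissible n f F \<longleftrightarrow> fp_ok n F \<and> card (faulty n F) \<le> f"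
  unfolding admissible_def faulty_def by simp

lemma admissibleI:
  assumes "fp_ok n F" "faulty n F \<subseteq> Z" "finite Z" "card Z \<le> f"
  shows "admissible n f F"
  using assms card_mono[of Z "faulty n F"] unfolding admissible_iff by simp

lemma faultyI: "i < n \<Longrightarrow> \<not> alive n F i r \<Longrightarrow> i \<in> faulty n F"
  unfolding faulty_def correct_iff_alive by blast

lemma undelivered_faulty: "i < n \<Longrightarrow> j < n \<Longrightarrow> 1 \<le> r \<Longrightarrow> (i, j, r) \<notin> F \<Longrightarrow> i \<in> faulty n F"
  unfolding faulty_def correct_def by blast

lemma faulty_card_le:
  assumes "admissible n f F" "Z \<subseteq> faulty n F"
  shows "card Z \<le> f"
  using assms card_mono[of "faulty n F" Z] unfolding admissible_iff by simp

text \<open>Every \<open>hist_at n F Q r i\<close> is the restriction of this one function to the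
  rounds up to \<open>r\<close>, so that claims about different times can refer to the same
  object.\<close>

definition rcv :: "nat \<Rightarrow> fpattern \<Rightarrow> 'v behav \<Rightarrow> nat \<Rightarrow> hist" where
  "rcv n F Q i t j =
     (if 1 \<le> t \<and> j < n \<and> (j, i, t) \<in> F then fst (Q j (t - 1) (hist_at n F Q (t - 1) j)) i else None)"

lemma hist_at_rcv: "hist_at n F Q r i = (\<lambda>t j. if t \<le> r then rcv n F Q i t j else None)"
  by (induction r) (auto simp: rcv_def fun_eq_iff)

declare hist_at.simps(2) [simp del]

lemma hist_at_le: "t \<le> r \<Longrightarrow> hist_at n F Q r i t = rcv n F Q i t"
  by (auto simp: hist_at_rcv fun_eq_iff)

lemma hist_at_SomeD: "hist_at n F Q r i t j = Some m \<Longrightarrow> t \<le> r \<and> rcv n F Q i t j = Some m"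
  by (auto simp: hist_at_rcv split: if_splits)

lemma hist_at_eqI:
  assumes "hist_at n F Q r i = hist_at n F' Q' r i" "\<And>j. j < n \<Longrightarrow> rcv n F Q i (Suc r) j = rcv n F' Q' i (Suc r) j"
  shows "hist_at n F Q (Suc r) i = hist_at n F' Q' (Suc r) i"
proof -
  have "rcv n F Q i (Suc r) j = rcv n F' Q' i (Suc r) j" for j
    using assms(2) by (cases "j < n") (auto simp: rcv_def)
  moreover have "t \<le> r \<Longrightarrow> rcv n F Q i t j = rcv n F' Q' i t j" for t j
    using fun_cong[OF fun_cong[OF assms(1)], of t j] by (simp add: hist_at_rcv)
  ultimately show ?thesis by (auto simp: hist_at_rcv fun_eq_iff le_Suc_eq)
qed

lemma hist_at_rounds_cong:
  assumes "\<And>i j t. t \<le> r \<Longrightarrow> (i, j, t) \<in> F \<longleftrightarrow> (i, j, t) \<in> F'"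
  shows "hist_at n F Q r i = hist_at n F' Q r i"
  using assms
proof (induction r arbitrary: i)
  case (Suc r)
  show ?case
  proof (rule hist_at_eqI)
    show "hist_at n F Q r i = hist_at n F' Q r i" using Suc by simp
    fix j show "rcv n F Q i (Suc r) j = rcv n F' Q i (Suc r) j"
      using Suc by (simp add: rcv_def)
  qed
qed simp

section \<open>The protocol\<close>

definition start :: "nat \<Rightarrow> nat \<Rightarrow> nat" where
  "start f e = e * (f + 4)"

lemma start_Suc: "start f (Suc e) = start f e + f + 4"
  by (simp add: start_def)

lemma start_less: "e' < e \<Longrightarrow> start f e' + f + 4 \<le> start f e"
  using mult_le_mono1[of "Suc e'" e "f + 4"] by (simp add: start_def)

lemma start_div [simp]: "s < f + 4 \<Longrightarrow> (start f e + s) div (f + 4) = e"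
  by (simp add: start_def div_mult_self3 add.commute)

lemma start_mod [simp]: "s < f + 4 \<Longrightarrow> (start f e + s) mod (f + 4) = s"
  by (simp add: start_def)

lemma start_inj:
  "s < f + 4 \<Longrightarrow> s' < f + 4 \<Longrightarrow> start f e + s = start f e' + s' \<longleftrightarrow> e' = e \<and> s = s'"
  by (metis start_div start_mod)

lemma start_cases:
  obtains e s where "r = start f e + s" "s < f + 4"
proof
  show "r = start f (r div (f + 4)) + r mod (f + 4)" by (simp only: start_def div_mult_mod_eq)
qed simp

text \<open>Epoch \<open>e\<close> consists of the rounds after time \<open>start f e\<close>: round \<open>1\<close> carries pings, round \<open>2\<close> reports
  to \<open>e\<close>, round \<open>3\<close> the proposal of \<open>e\<close>, and rounds \<open>4, \<dots>, f + 4\<close> statuses, where \<open>0\<close> stands for a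
  failed epoch and \<open>Suc w\<close> for proposal \<open>w\<close>. The coordinator ignores statuses, as it may have decided.\<close>

fun lbad :: "nat \<Rightarrow> nat \<Rightarrow> nat \<Rightarrow> hist \<Rightarrow> nat \<Rightarrow> nat \<Rightarrow> bool" where
  "lbad n f i h e 0 \<longleftrightarrow> i \<noteq> e \<and> h (start f e + 3) e = None"
| "lbad n f i h e (Suc q) \<longleftrightarrow>
     lbad n f i h e q \<or> (i \<noteq> e \<and> (\<exists>y<n. h (start f e + 4 + q) y = Some 0))"

definition running :: "nat \<Rightarrow> nat \<Rightarrow> nat \<Rightarrow> hist \<Rightarrow> nat \<Rightarrow> bool" where
  "running n f i h e \<longleftrightarrow> (\<forall>e'<e. lbad n f i h e' (Suc f))"

text \<open>The threshold means that at least \<open>f - 1\<close> agents besides \<open>e\<close>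
  sent no ping, so that a failure of \<open>e\<close> would exhaust the budget. Below it the
  favourite is withheld, because a report to a coordinator that fails would spoil the secret for
  later epochs.\<close>

definition report :: "nat \<Rightarrow> nat \<Rightarrow> ('v::finite \<times> 'v) set \<Rightarrow> hist \<Rightarrow> nat \<Rightarrow> nat" where
  "report n f \<theta> h e = to_nat
     (map (\<lambda>z. h (start f e + 1) z = None) [0..<n],
      if f \<le> Suc (card {z. z < n \<and> z \<noteq> e \<and> h (start f e + 1) z = None}) then Some (top_of \<theta>) else None)"

text \<open>Including all reports turns the proposal into a certificate of receipt: whoever relays
  it has to reproduce the report of the very agent that checks it.\<close>

definition proposal :: "nat \<Rightarrow> nat \<Rightarrow> ('v::finite \<times> 'v) set \<Rightarrow> hist \<Rightarrow> nat \<Rightarrow> nat" where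
  "proposal n f \<theta> h e = to_nat (top_of \<theta>, map (h (start f e + 2)) [0..<n])"

text \<open>The default \<open>the None\<close> is never consulted: the status and the decision use
  this value only for an agent that is not bad, and an agent other than \<open>e\<close> without the
  proposal is bad from the start.\<close>

definition proposal_of :: "nat \<Rightarrow> nat \<Rightarrow> nat \<Rightarrow> ('v::finite \<times> 'v) set \<Rightarrow> hist \<Rightarrow> nat \<Rightarrow> nat" where
  "proposal_of n f i \<theta> h e =
     (if i = e then proposal n f \<theta> h e else the (h (start f e + 3) e))"

definition status :: "nat \<Rightarrow> nat \<Rightarrow> nat \<Rightarrow> ('v::finite \<times> 'v) set \<Rightarrow> hist \<Rightarrow> nat \<Rightarrow> nat \<Rightarrow> nat" where
  "status n f i \<theta> h e q = (if lbad n f i h e q then 0 else Suc (proposal_of n f i \<theta> h e))"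

text \<open>Reports are only awaited by the coordinator and not counted here.\<close>

definition suspects :: "nat \<Rightarrow> nat \<Rightarrow> hist \<Rightarrow> nat \<Rightarrow> nat set" where
  "suspects n f h r = {j. j < n \<and> (\<exists>e.
      start f e + 1 \<le> r \<and> h (start f e + 1) j = None \<or>
      start f e + 3 \<le> r \<and> j = e \<and> h (start f e + 3) j = None \<or>
      (\<exists>q\<le>f. start f e + 4 + q \<le> r \<and> h (start f e + 4 + q) j = None))}"

text \<open>Three refutations of a claimed receipt, one for each main case of
  \<open>forged_status\<close>: an agent whose ping is missing has crashed before the proposal
  round; a genuine proposal contains the receiver's own report; it coincides with a copy obtained
  directly.\<close>

definition forged :: "nat \<Rightarrow> nat \<Rightarrow> nat \<Rightarrow> ('v::finite \<times> 'v) set \<Rightarrow> hist \<Rightarrow> nat \<Rightarrow> nat \<Rightarrow> nat \<Rightarrow> bool" where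
  "forged n f i \<theta> h e j w \<longleftrightarrow> e \<noteq> i \<and> j < n \<and> h (start f e + 4) j = Some (Suc w) \<and>
     (h (start f e + 1) e = None \<or>
      snd (from_nat w :: 'v \<times> nat option list) ! i \<noteq> Some (report n f \<theta> h e) \<or>
      (\<exists>w'. w' \<noteq> w \<and> h (start f e + 3) e = Some w'))"

text \<open>A status from \<open>e\<close> in the first flooding round proves that its broadcast was
  complete, so nobody can have missed it.\<close>

definition late :: "nat \<Rightarrow> nat \<Rightarrow> nat \<Rightarrow> hist \<Rightarrow> nat \<Rightarrow> nat \<Rightarrow> nat \<Rightarrow> bool" where
  "late n f i h e j q \<longleftrightarrow> e \<noteq> i \<and> j < n \<and> q \<le> f \<and>
     h (start f e + 4) e \<noteq> None \<and> h (start f e + 4 + q) j = Some 0"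

text \<open>That \<open>y\<close> still speaks one round after announcing a failure proves that the
  announcement reached everybody, in particular \<open>j\<close>. The case \<open>y = j\<close> is
  included: an agent must not revoke its own announcement.\<close>

definition switched :: "nat \<Rightarrow> nat \<Rightarrow> nat \<Rightarrow> hist \<Rightarrow> nat \<Rightarrow> nat \<Rightarrow> nat \<Rightarrow> nat \<Rightarrow> nat \<Rightarrow> bool" where
  "switched n f i h e j y q w \<longleftrightarrow> e \<noteq> i \<and> j < n \<and> y < n \<and> q < f \<and> h (start f e + 4 + q) y = Some 0 \<and>
     h (start f e + 5 + q) y \<noteq> None \<and> h (start f e + 5 + q) j = Some (Suc w)"

definition alarm :: "nat \<Rightarrow> nat \<Rightarrow> nat \<Rightarrow> ('v::finite \<times> 'v) set \<Rightarrow> hist \<Rightarrow> nat \<Rightarrow> bool" where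
  "alarm n f i \<theta> h r \<longleftrightarrow> f < card (suspects n f h r) \<or> (\<exists>e j w. forged n f i \<theta> h e j w) \<or>
     (\<exists>e j q. late n f i h e j q) \<or> (\<exists>e j y q w. switched n f i h e j y q w)"

definition prot_msg :: "nat \<Rightarrow> nat \<Rightarrow> nat \<Rightarrow> ('v::finite \<times> 'v) set \<Rightarrow> nat \<Rightarrow> hist \<Rightarrow> nat \<Rightarrow> nat option" where
  "prot_msg n f i \<theta> r h x =
     (let e = r div (f + 4); s = r mod (f + 4) in
      if \<not> running n f i h e then None
      else if s = 0 then Some 0
      else if s = 1 then (if x = e then Some (report n f \<theta> h e) else None)
      else if s = 2 then (if i = e then Some (proposal n f \<theta> h e) else None)
      else Some (status n f i \<theta> h e (s - 3)))"

text \<open>Time \<open>s = 0\<close> of epoch \<open>e\<close> is the end of epoch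
  \<open>e - 1\<close>, hence the shifted index. An alarm never triggers a decision; it only spoils
  the value of one that is due anyway.\<close>

definition prot_dec :: "nat \<Rightarrow> nat \<Rightarrow> nat \<Rightarrow> ('v::finite \<times> 'v) set \<Rightarrow> nat \<Rightarrow> hist \<Rightarrow> 'v dec option" where
  "prot_dec n f i \<theta> r h =
     (let e = r div (f + 4); s = r mod (f + 4);
          verdict = (\<lambda>w. Some (if alarm n f i \<theta> h r then Top else Val (fst (from_nat w :: 'v \<times> nat option list)))) in
      if s = 3 \<and> i = e \<and> running n f i h e then verdict (proposal n f \<theta> h e)
      else if s = 0 \<and> 0 < e \<and> running n f i h (e - 1) \<and> \<not> lbad n f i h (e - 1) (Suc f)
        then verdict (proposal_of n f i \<theta> h (e - 1))
      else None)"

definition prot :: "nat \<Rightarrow> nat \<Rightarrow> 'v::finite protocol" where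
  "prot n f i \<theta> r h = (prot_msg n f i \<theta> r h, prot_dec n f i \<theta> r h)"

section \<open>Failed epochs\<close>

text \<open>The status an agent has according to the failure pattern if everybody follows the protocol.\<close>

fun fbad :: "nat \<Rightarrow> nat \<Rightarrow> fpattern \<Rightarrow> nat \<Rightarrow> nat \<Rightarrow> nat \<Rightarrow> bool" where
  "fbad n f F e 0 k \<longleftrightarrow> k \<noteq> e \<and> (e, k, start f e + 3) \<notin> F"
| "fbad n f F e (Suc q) k \<longleftrightarrow>
     fbad n f F e q k \<or> (k \<noteq> e \<and> (\<exists>y<n. fbad n f F e q y \<and> (y, k, start f e + 4 + q) \<in> F))"

lemma fbad_mono: "fbad n f F e q k \<Longrightarrow> q \<le> q' \<Longrightarrow> fbad n f F e q' k"
  by (induction q') (auto simp: le_Suc_eq)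

lemma fbad_coord [simp]: "\<not> fbad n f F e q e"
  by (induction q) auto

lemma fbad_none:
  assumes "\<And>x. x < n \<Longrightarrow> (e, x, start f e + 3) \<in> F"
  shows "k < n \<Longrightarrow> \<not> fbad n f F e q k"
  using assms by (induction q arbitrary: k) auto

lemma fbad_cong:
  assumes "\<And>i j t. t \<le> start f e + 3 + q \<Longrightarrow> (i, j, t) \<in> F \<longleftrightarrow> (i, j, t) \<in> F'"
  shows "fbad n f F e q k \<longleftrightarrow> fbad n f F' e q k"
  using assms by (induction q arbitrary: k) auto

definition succ_ep :: "nat \<Rightarrow> nat \<Rightarrow> fpattern \<Rightarrow> nat \<Rightarrow> bool" where
  "succ_ep n f F e \<longleftrightarrow> (\<forall>x<n. alive n F x (start f e + f + 4) \<longrightarrow> \<not> fbad n f F e (Suc f) x)"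

text \<open>The counterpart of \<open>running\<close> on the level of failure patterns, as
  \<open>fbad\<close> is that of \<open>lbad\<close>; \<open>sync\<close> links both pairs.\<close>

definition act :: "nat \<Rightarrow> nat \<Rightarrow> fpattern \<Rightarrow> nat \<Rightarrow> bool" where
  "act n f F e \<longleftrightarrow> (\<forall>e'<e. \<not> succ_ep n f F e')"

text \<open>A status that spreads to some agents but not to one that survives the epoch needs
  a fresh crash in every flooding round.\<close>

lemma fbad_agree:
  assumes adm: "admissible n f F" and xy: "x < n" "y < n"
    and al: "alive n F x (start f e + f + 4)" "alive n F y (start f e + f + 4)"
    and bx: "fbad n f F e (Suc f) x"
  shows "fbad n f F e (Suc f) y"
proof (rule ccontr)
  assume ny: "\<not> fbad n f F e (Suc f) y"
  let ?B = "fbad n f F e"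
  \<comment> \<open>A coordinator that survives has delivered its proposal to everybody, and then
    nobody is bad.\<close>
  have ye: "y \<noteq> e"
  proof
    assume "y = e"
    hence "\<And>x. x < n \<Longrightarrow> (e, x, start f e + 3) \<in> F" using al(2) by (auto intro: aliveD)
    thus False using fbad_none[of n e f F x] bx xy by blast
  qed
  have nyq: "\<not> ?B q y" if "q \<le> Suc f" for q using ny fbad_mono that by blast
  have step: "\<not> alive n F z (start f e + 4 + q)" if "?B q z" "q \<le> f" "z < n" for z q
  proof
    assume "alive n F z (start f e + 4 + q)"
    hence "(z, y, start f e + 4 + q) \<in> F" using xy by (auto intro: aliveD)
    hence "?B (Suc q) y" using that ye by auto
    moreover have "\<not> ?B (Suc q) y" by (rule nyq) (use that in simp)
    ultimately show False by contradiction
  qed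
  \<comment> \<open>As \<open>q\<close> is minimal for \<open>x'\<close>, an informant
    \<open>z\<close> is itself newly bad at \<open>q - 1\<close>. It crashes exactly in the round in
    which it informs \<open>x'\<close>, since a full delivery would have reached \<open>y\<close>;
    so the count grows by one per round.\<close>
  have main: "q \<le> card {z. z < n \<and> \<not> alive n F z (start f e + 3 + q)}"
    if "?B q x'" "\<forall>q'<q. \<not> ?B q' x'" "q \<le> Suc f" "x' < n" for q x'
    using that
  proof (induction q arbitrary: x')
    case (Suc q)
    then obtain z where z: "z < n" "?B q z" "(z, x', start f e + 4 + q) \<in> F" by auto
    have fp: "fp_ok n F" using adm by (simp add: admissible_iff)
    have az: "alive n F z (start f e + 3 + q)" using fp_okD(4)[OF fp z(3)] by (simp add: eval_nat_numeral)
    have "\<forall>q'<q. \<not> ?B q' z"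
    proof (intro allI impI notI)
      fix q' assume "q' < q" "?B q' z"
      hence "\<not> alive n F z (start f e + 4 + q')" using step z Suc.prems by auto
      thus False using alive_mono[OF az] \<open>q' < q\<close> by auto
    qed
    hence "q \<le> card {z. z < n \<and> \<not> alive n F z (start f e + 3 + q)}" using Suc z by auto
    also have "\<dots> < card {z. z < n \<and> \<not> alive n F z (start f e + 3 + Suc q)}"
    proof (rule psubset_card_mono)
      have "z \<in> {z. z < n \<and> \<not> alive n F z (start f e + 3 + Suc q)}"
        using step[of q z] z Suc.prems by (auto simp: eval_nat_numeral)
      thus "{z. z < n \<and> \<not> alive n F z (start f e + 3 + q)} \<subset> {z. z < n \<and> \<not> alive n F z (start f e + 3 + Suc q)}"
        using az alive_mono[of n F _ "start f e + 3 + Suc q" "start f e + 3 + q"] by force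
    qed simp
    finally show ?case by simp
  qed simp
  have nx: "\<not> ?B q x" if "q < Suc f" for q
    using step[of q x] alive_mono[OF al(1)] that xy by force
  have "Suc f \<le> card {z. z < n \<and> \<not> alive n F z (start f e + 3 + Suc f)}"
    using main[of "Suc f" x] bx nx xy by blast
  also have "\<dots> \<le> f" by (rule faulty_card_le[OF adm]) (auto intro: faultyI)
  finally show False by simp
qed

lemma act_bad:
  assumes "admissible n f F" "act n f F e" "e' < e" "k < n" "alive n F k (start f e' + f + 4)"
  shows "fbad n f F e' (Suc f) k"
  using assms fbad_agree unfolding act_def succ_ep_def by blast

lemma act_coord:
  assumes "act n f F e" "e' < e"
  shows "\<not> alive n F e' (start f e' + 3)"
proof
  assume "alive n F e' (start f e' + 3)"
  hence "\<And>x. x < n \<Longrightarrow> (e', x, start f e' + 3) \<in> F" by (auto intro: aliveD)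
  hence "succ_ep n f F e'" unfolding succ_ep_def using fbad_none by blast
  thus False using assms unfolding act_def by blast
qed

lemma act_coord_faulty:
  assumes "act n f F e" "e' < e" "e \<le> n"
  shows "e' \<in> faulty n F"
  using act_coord[OF assms(1,2)] assms by (auto intro: faultyI)

lemma act_neq:
  assumes "act n f F e" "e' < e" "alive n F k (start f e)"
  shows "e' \<noteq> k"
  using act_coord[OF assms(1,2)] alive_mono[OF assms(3)] start_less[OF assms(2), of f] by auto

lemma act_cong:
  assumes "\<And>i j t. t \<le> start f e \<Longrightarrow> (i, j, t) \<in> F \<longleftrightarrow> (i, j, t) \<in> F'"
  shows "act n f F e \<longleftrightarrow> act n f F' e"
proof -
  have "succ_ep n f F e' \<longleftrightarrow> succ_ep n f F' e'" if "e' < e" for e'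
  proof -
    have l: "start f e' + f + 4 \<le> start f e" using start_less[OF that, of f] by simp
    have "alive n F x (start f e' + f + 4) \<longleftrightarrow> alive n F' x (start f e' + f + 4)" for x
      by (rule alive_cong) (use assms l in auto)
    moreover have "fbad n f F e' (Suc f) x \<longleftrightarrow> fbad n f F' e' (Suc f) x" for x
      by (rule fbad_cong) (use assms l in auto)
    ultimately show ?thesis unfolding succ_ep_def by auto
  qed
  thus ?thesis unfolding act_def by auto
qed

text \<open>Each failed epoch costs the life of its own coordinator, so the epochs \<open>0\<close>
  to \<open>f\<close> cannot all fail.\<close>

lemma ex_succ_ep:
  assumes adm: "admissible n f F" and fn: "f + 2 \<le> n"
  obtains e where "e \<le> f" "succ_ep n f F e" "act n f F e"
proof -
  have "\<exists>e\<le>f. succ_ep n f F e"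
  proof (rule ccontr)
    assume a: "\<not> ?thesis"
    hence "act n f F (Suc f)" unfolding act_def by auto
    hence "{..f} \<subseteq> faulty n F" using act_coord_faulty[of n f F "Suc f"] fn by auto
    from faulty_card_le[OF adm this] show False by simp
  qed
  then obtain e0 where "e0 \<le> f" "succ_ep n f F e0" by blast
  thus ?thesis using that[of "LEAST e. succ_ep n f F e"] LeastI[of "succ_ep n f F" e0]
      not_less_Least[of _ "succ_ep n f F"] Least_le[of "succ_ep n f F" e0] unfolding act_def
    by (meson order_trans)
qed

lemma act_le:
  assumes "admissible n f F" "f + 2 \<le> n" "act n f F e"
  shows "e \<le> f"
proof -
  obtain e' where "e' \<le> f" "succ_ep n f F e'" by (rule ex_succ_ep[OF assms(1,2)])
  moreover have "\<not> e' < e" using assms(3) calculation unfolding act_def by blast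
  ultimately show ?thesis by simp
qed

section \<open>Locality of the protocol\<close>

lemma lbad_cong:
  assumes "\<And>t. t \<le> start f e + 3 + q \<Longrightarrow> h t = h' t"
  shows "lbad n f i h e q \<longleftrightarrow> lbad n f i h' e q"
  using assms by (induction q) auto

lemma lbad_coord [simp]: "\<not> lbad n f e h e q"
  by (induction q) auto

lemma running_cong:
  assumes "\<And>t. t \<le> start f e \<Longrightarrow> h t = h' t"
  shows "running n f i h e \<longleftrightarrow> running n f i h' e"
proof -
  have "lbad n f i h e' (Suc f) \<longleftrightarrow> lbad n f i h' e' (Suc f)" if "e' < e" for e'
    by (rule lbad_cong) (use assms start_less[OF that, of f] in auto)
  thus ?thesis unfolding running_def by auto
qed

lemma report_cong: "h (start f e + 1) = h' (start f e + 1) \<Longrightarrow> report n f \<theta> h e = report n f \<theta> h' e"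
  unfolding report_def by simp

lemma proposal_cong: "h (start f e + 2) = h' (start f e + 2) \<Longrightarrow> proposal n f \<theta> h e = proposal n f \<theta> h' e"
  unfolding proposal_def by simp

lemma proposal_of_cong:
  "h (start f e + 2) = h' (start f e + 2) \<Longrightarrow> h (start f e + 3) = h' (start f e + 3)
    \<Longrightarrow> proposal_of n f i \<theta> h e = proposal_of n f i \<theta> h' e"
  unfolding proposal_of_def proposal_def by simp

lemma status_cong:
  assumes "\<And>t. t \<le> start f e + 3 + q \<Longrightarrow> h t = h' t"
  shows "status n f i \<theta> h e q = status n f i \<theta> h' e q"
  unfolding status_def using lbad_cong[of f e q h h' n i] proposal_of_cong[of h f e h' n i \<theta>] assms by simp

section \<open>Conformity of deviating agents and its effect on honest ones\<close>

locale deviation =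
  fixes n f :: nat and C :: "nat set" and s' :: "'v::finite jprofile"
begin

abbreviation behaviour :: "(nat \<Rightarrow> ('v \<times> 'v) set) \<Rightarrow> 'v behav" where
  "behaviour th \<equiv> (\<lambda>i. deviate (prot n f) C s' i th)"

abbreviation H :: "fpattern \<Rightarrow> (nat \<Rightarrow> ('v \<times> 'v) set) \<Rightarrow> nat \<Rightarrow> nat \<Rightarrow> hist" where
  "H F th \<equiv> hist_at n F (behaviour th)"

abbreviation R :: "fpattern \<Rightarrow> (nat \<Rightarrow> ('v \<times> 'v) set) \<Rightarrow> nat \<Rightarrow> hist" where
  "R F th \<equiv> rcv n F (behaviour th)"

lemma running_H: "start f e \<le> r \<Longrightarrow> running n f i (H F th r i) e \<longleftrightarrow> running n f i (R F th i) e"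
  by (rule running_cong) (simp add: hist_at_le)

lemma lbad_H: "start f e + 3 + q \<le> r \<Longrightarrow> lbad n f i (H F th r i) e q \<longleftrightarrow> lbad n f i (R F th i) e q"
  by (rule lbad_cong) (simp add: hist_at_le)

lemma R_at:
  "t = Suc r \<Longrightarrow> R F th k t j = (if j < n \<and> (j, k, t) \<in> F then fst (behaviour th j r (H F th r j)) k else None)"
  by (simp add: rcv_def)

lemma R_honest:
  assumes "y \<notin> C" "s < f + 4" "t = start f e + s + 1"
  shows "R F th k t y =
    (if y < n \<and> (y, k, t) \<in> F \<and> running n f y (R F th y) e then
       if s = 0 then Some 0
       else if s = 1 then (if k = e then Some (report n f (th y) (R F th y) e) else None)
       else if s = 2 then (if y = e then Some (proposal n f (th y) (R F th y) e) else None)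
       else Some (status n f y (th y) (R F th y) e (s - 3))
     else None)"
proof -
  let ?r = "start f e + s"
  have 1: "R F th k t y = (if y < n \<and> (y, k, t) \<in> F then prot_msg n f y (th y) ?r (H F th ?r y) k else None)"
    using R_at[of t ?r F th k y] assms by (simp add: deviate_def prot_def)
  have 2: "running n f y (H F th ?r y) e \<longleftrightarrow> running n f y (R F th y) e"
    by (rule running_H) simp
  have 3: "1 \<le> s \<Longrightarrow> report n f (th y) (H F th ?r y) e = report n f (th y) (R F th y) e"
    by (rule report_cong, rule hist_at_le) simp
  have 4: "2 \<le> s \<Longrightarrow> proposal n f (th y) (H F th ?r y) e = proposal n f (th y) (R F th y) e"
    by (rule proposal_cong, rule hist_at_le) simp
  have 5: "3 \<le> s \<Longrightarrow> status n f y (th y) (H F th ?r y) e (s - 3) = status n f y (th y) (R F th y) e (s - 3)"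
    by (rule status_cong, rule hist_at_le) simp
  show ?thesis unfolding 1 prot_msg_def Let_def start_div[OF assms(2)] start_mod[OF assms(2)] 2
    using 3 4 5 by (auto simp: numeral_3_eq_3)
qed

lemma msg_ping:
  "y \<notin> C \<Longrightarrow> running n f y (R F th y) e \<Longrightarrow>
   R F th k (start f e + 1) y = (if y < n \<and> (y, k, start f e + 1) \<in> F then Some 0 else None)"
  by (subst R_honest[where s = 0 and e = e]) auto

lemma msg_report:
  "y \<notin> C \<Longrightarrow> running n f y (R F th y) e \<Longrightarrow>
   R F th e (start f e + 2) y = (if y < n \<and> (y, e, start f e + 2) \<in> F
     then Some (report n f (th y) (R F th y) e) else None)"
  by (subst R_honest[where s = 1 and e = e]) auto

lemma msg_report_None: "y \<notin> C \<Longrightarrow> k \<noteq> e \<Longrightarrow> R F th k (start f e + 2) y = None"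
  by (subst R_honest[where s = 1 and e = e]) auto

lemma msg_proposal:
  "e \<notin> C \<Longrightarrow> running n f e (R F th e) e \<Longrightarrow>
   R F th k (start f e + 3) e = (if e < n \<and> (e, k, start f e + 3) \<in> F
     then Some (proposal n f (th e) (R F th e) e) else None)"
  by (subst R_honest[where s = 2 and e = e]) auto

lemma msg_proposal_None: "y \<notin> C \<Longrightarrow> y \<noteq> e \<Longrightarrow> R F th k (start f e + 3) y = None"
  by (subst R_honest[where s = 2 and e = e]) auto

lemma msg_status:
  "y \<notin> C \<Longrightarrow> running n f y (R F th y) e \<Longrightarrow> q \<le> f \<Longrightarrow>
   R F th k (start f e + 4 + q) y = (if y < n \<and> (y, k, start f e + 4 + q) \<in> F
     then Some (status n f y (th y) (R F th y) e q) else None)"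
  by (subst R_honest[where s = "3 + q" and e = e]) auto

text \<open>The messages of deviating agents that matter are those that the protocol prescribes.
  Nothing can be said about statuses sent to the coordinator, which may have decided.\<close>

definition pres :: "nat \<Rightarrow> bool" where
  "pres t \<longleftrightarrow> (\<forall>F th j k e. admissible n f F \<longrightarrow> types_ok n th \<longrightarrow> act n f F e \<longrightarrow> j \<in> C \<longrightarrow> k \<notin> C \<longrightarrow>
     alive n F k (t - 1) \<longrightarrow> (j, k, t) \<in> F \<longrightarrow>
     t = start f e + 1 \<or> t = start f e + 3 \<and> j = e \<or> (\<exists>q\<le>f. t = start f e + 4 + q \<and> k \<noteq> e) \<longrightarrow>
     R F th k t j \<noteq> None)"

definition flag :: "nat \<Rightarrow> bool" where
  "flag t \<longleftrightarrow> (\<forall>F th j k e q. admissible n f F \<longrightarrow> types_ok n th \<longrightarrow> act n f F e \<longrightarrow> j \<in> C \<longrightarrow> k \<notin> C \<longrightarrow>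
     alive n F k (t - 1) \<longrightarrow> (j, k, t) \<in> F \<longrightarrow> q \<le> f \<longrightarrow> t = start f e + 4 + q \<longrightarrow> k \<noteq> e \<longrightarrow>
     (R F th k t j = Some 0 \<longleftrightarrow> fbad n f F e q j))"

definition exact :: "nat \<Rightarrow> bool" where
  "exact T \<longleftrightarrow> (\<forall>t\<le>T. pres t \<and> flag t)"

text \<open>Both claims are proved in one induction over epochs, because running in epoch
  \<open>e\<close> rests on the final statuses of all earlier epochs. Honest senders are covered by
  the induction hypotheses, colluding senders by \<open>pres\<close> and
  \<open>flag\<close>.\<close>

lemma sync:
  assumes ex: "exact T" and adm: "admissible n f F" and ty: "types_ok n th"
  shows "(act n f F e \<longrightarrow> k < n \<longrightarrow> k \<notin> C \<longrightarrow> alive n F k (start f e) \<longrightarrow> start f e \<le> T \<longrightarrow> running n f k (R F th k) e) \<and>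
    (act n f F e \<longrightarrow> k < n \<longrightarrow> k \<notin> C \<longrightarrow> q \<le> Suc f \<longrightarrow> alive n F k (start f e + 3 + q) \<longrightarrow> start f e + 3 + q \<le> T \<longrightarrow>
       (lbad n f k (R F th k) e q \<longleftrightarrow> fbad n f F e q k))"
proof (induction e arbitrary: k q rule: less_induct)
  case (less e)
  have fp: "fp_ok n F" using adm by (simp add: admissible_iff)
  have run: "running n f k (R F th k) e"
    if "act n f F e" "k < n" "k \<notin> C" "alive n F k (start f e)" "start f e \<le> T" for k
    unfolding running_def
  proof (intro allI impI)
    fix e' assume e': "e' < e"
    have l: "start f e' + f + 4 \<le> start f e" using start_less[OF e', of f] .
    have ae': "act n f F e'" using that(1) e' unfolding act_def by auto
    have al: "alive n F k (start f e' + f + 4)" using that(4) l alive_mono by blast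
    have "lbad n f k (R F th k) e' (Suc f) \<longleftrightarrow> fbad n f F e' (Suc f) k"
      using less.IH[OF e', of k "Suc f"] ae' that al l by (simp add: eval_nat_numeral)
    thus "lbad n f k (R F th k) e' (Suc f)" using act_bad[OF adm that(1) e' that(2) al] by simp
  qed
  have st: "lbad n f k (R F th k) e q \<longleftrightarrow> fbad n f F e q k"
    if "act n f F e" "k < n" "k \<notin> C" "q \<le> Suc f" "alive n F k (start f e + 3 + q)" "start f e + 3 + q \<le> T" for k q
    using that
  proof (induction q arbitrary: k)
    case 0
    show ?case
    proof (cases "k = e")
      case False
      have "R F th k (start f e + 3) e = None \<longleftrightarrow> (e, k, start f e + 3) \<notin> F"
      proof (cases "(e, k, start f e + 3) \<in> F")
        case True
        note d = fp_okD[OF fp True]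
        have ae: "alive n F e (start f e)" using alive_mono[OF d(4)] by simp
        show ?thesis
        proof (cases "e \<in> C")
          case eC: True
          have "pres (start f e + 3)" using ex 0 unfolding exact_def by auto
          moreover have "alive n F k (start f e + 3 - 1)" using alive_mono[OF 0(5)] by simp
          ultimately show ?thesis unfolding pres_def using adm ty 0 eC True by blast
        next
          case False
          show ?thesis using msg_proposal[OF False run[OF 0(1) d(1) False ae]] 0 d True by simp
        qed
      qed (simp add: rcv_def)
      thus ?thesis using False by simp
    qed simp
  next
    case (Suc q)
    have IH: "lbad n f k' (R F th k') e q \<longleftrightarrow> fbad n f F e q k'"
      if "k' < n" "k' \<notin> C" "alive n F k' (start f e + 3 + q)" for k'
      using Suc.IH[OF Suc.prems(1) that(1,2)] Suc.prems that by simp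
    have alk: "alive n F k (start f e + 3 + q)" by (rule alive_mono[OF Suc.prems(5)]) simp
    show ?case
    proof (cases "k = e")
      case False
      have "R F th k (start f e + 4 + q) y = Some 0 \<longleftrightarrow> fbad n f F e q y \<and> (y, k, start f e + 4 + q) \<in> F" if y: "y < n" for y
      proof (cases "(y, k, start f e + 4 + q) \<in> F")
        case True
        have aly: "alive n F y (start f e + 3 + q)" using fp_okD(4)[OF fp True] by (simp add: eval_nat_numeral)
        show ?thesis
        proof (cases "y \<in> C")
          case yC: True
          have "flag (start f e + 4 + q)" using ex Suc unfolding exact_def by auto
          moreover have "alive n F k (start f e + 4 + q - 1)" using alk by (simp add: eval_nat_numeral)
          moreover have "q \<le> f" using Suc by simp
          ultimately show ?thesis unfolding flag_def using adm ty Suc.prems yC True False by blast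
        next
          case yC: False
          have r: "running n f y (R F th y) e"
            by (rule run) (use Suc.prems yC y alive_mono[OF aly] in auto)
          show ?thesis
            using msg_status[OF yC r, of q k] True y Suc.prems IH[OF y yC aly] by (simp add: status_def)
        qed
      qed (simp add: rcv_def)
      thus ?thesis using IH[OF Suc.prems(2,3) alk] False by auto
    qed simp
  qed
  show ?case using run[of k] st[of k q] by blast
qed

lemmas sync_running = sync[THEN conjunct1, rule_format]
lemmas sync_status = sync[THEN conjunct2, rule_format]

end

section \<open>Failure patterns in which a chosen agent no longer crashes\<close>

lemma faulty_mono: "F \<subseteq> F' \<Longrightarrow> faulty n F' \<subseteq> faulty n F"
  unfolding faulty_def correct_def by blast

text \<open>Makes an observer correct from the round of the lie on: deliveries before round
  \<open>t\<close> are untouched, and no agent becomes faulty.\<close>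

definition revive :: "nat \<Rightarrow> nat \<Rightarrow> nat \<Rightarrow> fpattern \<Rightarrow> fpattern" where
  "revive n k t F = F \<union> {(k, x, r) | x r. x < n \<and> t \<le> r}"

lemma in_revive [simp]: "(y, x, r) \<in> revive n k t F \<longleftrightarrow> (y, x, r) \<in> F \<or> (y = k \<and> x < n \<and> t \<le> r)"
  unfolding revive_def by auto

lemma revive_alive:
  assumes "alive n F k (t - 1)"
  shows "alive n (revive n k t F) k r"
  using assms unfolding alive_def by force

lemma alive_superset: "alive n F i r \<Longrightarrow> F \<subseteq> F' \<Longrightarrow> alive n F' i r"
  unfolding alive_def by blast

lemma subset_revive: "F \<subseteq> revive n k t F"
  unfolding revive_def by blast

lemma fp_ok_revive:
  assumes "fp_ok n F" "alive n F k (t - 1)" "k < n" "1 \<le> t"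
  shows "fp_ok n (revive n k t F)"
proof (rule fp_okI)
  fix i j r assume a: "(i, j, r) \<in> revive n k t F"
  show "i < n \<and> j < n \<and> 1 \<le> r \<and> alive n (revive n k t F) i (r - 1)"
    using a fp_okD[OF assms(1)] revive_alive[OF assms(2)] assms(3,4)
      alive_superset[OF _ subset_revive] by auto
qed

lemma adm_revive:
  assumes "admissible n f F" "alive n F k (t - 1)" "k < n" "1 \<le> t"
  shows "admissible n f (revive n k t F)"
  using admissibleI[OF fp_ok_revive faulty_mono[OF subset_revive]] assms finite_faulty
  unfolding admissible_iff by blast

lemma correct_revive: "alive n F k (t - 1) \<Longrightarrow> correct n (revive n k t F) k"
  unfolding correct_iff_alive using revive_alive by blast

section \<open>Causes of alarms and times of decisions\<close>

context deviation
begin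

lemma R_rounds_cong:
  assumes "\<And>i j t. t \<le> r \<Longrightarrow> (i, j, t) \<in> F \<longleftrightarrow> (i, j, t) \<in> F'" "t \<le> r"
  shows "R F th k t = R F' th k t"
proof -
  have "H F th r k = H F' th r k" by (rule hist_at_rounds_cong) (rule assms(1))
  thus ?thesis by (simp add: hist_at_le[OF assms(2), symmetric])
qed

lemma suspects_H:
  "suspects n f (H F th r k) r = {j. j < n \<and> (\<exists>e.
      start f e + 1 \<le> r \<and> R F th k (start f e + 1) j = None \<or>
      start f e + 3 \<le> r \<and> j = e \<and> R F th k (start f e + 3) j = None \<or>
      (\<exists>q\<le>f. start f e + 4 + q \<le> r \<and> R F th k (start f e + 4 + q) j = None))}"
  unfolding suspects_def by (simp add: hist_at_le cong: conj_cong)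

lemma suspects_ping:
  "j < n \<Longrightarrow> start f e + 1 \<le> r \<Longrightarrow> R F th k (start f e + 1) j = None \<Longrightarrow> j \<in> suspects n f (H F th r k) r"
  unfolding suspects_H by blast

lemma suspects_proposal:
  "e < n \<Longrightarrow> start f e + 3 \<le> r \<Longrightarrow> R F th k (start f e + 3) e = None \<Longrightarrow> e \<in> suspects n f (H F th r k) r"
  unfolding suspects_H by blast

lemma suspects_status:
  "j < n \<Longrightarrow> q \<le> f \<Longrightarrow> start f e + 4 + q \<le> r \<Longrightarrow> R F th k (start f e + 4 + q) j = None
    \<Longrightarrow> j \<in> suspects n f (H F th r k) r"
  unfolding suspects_H by blast

lemma alarm_suspects:
  assumes "f < card Z" "Z \<subseteq> suspects n f (H F th r k) r"
  shows "alarm n f k \<theta> (H F th r k) r"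
proof -
  have "finite (suspects n f (H F th r k) r)" unfolding suspects_def by simp
  hence "f < card (suspects n f (H F th r k) r)" using card_mono[OF _ assms(2)] assms(1) by linarith
  thus ?thesis unfolding alarm_def by blast
qed

lemma alarm_forged:
  fixes \<theta> :: "('v \<times> 'v) set"
  assumes "e \<noteq> k" "j < n" "R F th k (start f e + 4) j = Some (Suc w)"
    and "R F th k (start f e + 1) e = None
      \<or> snd (from_nat w :: 'v \<times> nat option list) ! k \<noteq> Some (report n f \<theta> (R F th k) e)
      \<or> (\<exists>w'. w' \<noteq> w \<and> R F th k (start f e + 3) e = Some w')"
    and "start f e + 4 \<le> r"
  shows "alarm n f k \<theta> (H F th r k) r"
proof -
  have "report n f \<theta> (H F th r k) e = report n f \<theta> (R F th k) e"
    by (rule report_cong, rule hist_at_le) (use assms in simp)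
  hence "forged n f k \<theta> (H F th r k) e j w"
    unfolding forged_def using assms by (simp add: hist_at_le)
  thus ?thesis unfolding alarm_def by blast
qed

lemma alarm_late:
  assumes "e \<noteq> k" "j < n" "q \<le> f" "R F th k (start f e + 4) e \<noteq> None" "R F th k (start f e + 4 + q) j = Some 0"
    and "start f e + 4 + f \<le> r"
  shows "alarm n f k \<theta> (H F th r k) r"
proof -
  have "late n f k (H F th r k) e j q" unfolding late_def using assms by (simp add: hist_at_le)
  thus ?thesis unfolding alarm_def by blast
qed

lemma alarm_switch:
  assumes "e \<noteq> k" "j < n" "y < n" "q < f" "R F th k (start f e + 4 + q) y = Some 0"
    "R F th k (start f e + 5 + q) y \<noteq> None" "R F th k (start f e + 5 + q) j = Some (Suc w)"
    and "start f e + 4 + f \<le> r"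
  shows "alarm n f k \<theta> (H F th r k) r"
proof -
  have "switched n f k (H F th r k) e j y q w" unfolding switched_def using assms by (simp add: hist_at_le)
  thus ?thesis unfolding alarm_def by blast
qed

abbreviation dout :: "fpattern \<Rightarrow> (nat \<Rightarrow> ('v \<times> 'v) set) \<Rightarrow> nat \<Rightarrow> nat \<Rightarrow> 'v dec option" where
  "dout F th \<equiv> dec_out n F (behaviour th)"

definition verdict :: "fpattern \<Rightarrow> (nat \<Rightarrow> ('v \<times> 'v) set) \<Rightarrow> nat \<Rightarrow> nat \<Rightarrow> nat \<Rightarrow> 'v dec" where
  "verdict F th k r e = (if alarm n f k (th k) (H F th r k) r then Top
     else Val (fst (from_nat (proposal_of n f k (th k) (R F th k) e) :: 'v \<times> nat option list)))"

lemma dout_iff: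
  assumes "k \<notin> C"
  shows "dout F th k r = Some d \<longleftrightarrow> (\<exists>e. running n f k (R F th k) e \<and> d = verdict F th k r e \<and>
      (r = start f e + 3 \<and> k = e \<or> r = start f e + f + 4 \<and> \<not> lbad n f k (R F th k) e (Suc f)))"
proof -
  obtain e s where r: "r = start f e + s" and s: "s < f + 4" by (rule start_cases)
  have dd: "dout F th k r = prot_dec n f k (th k) r (H F th r k)"
    unfolding dec_out_def using assms by (simp add: deviate_def prot_def)
  have eq3: "start f e + s = start f e' + 3 \<longleftrightarrow> e' = e \<and> s = 3" for e'
    by (rule start_inj) (use s in simp_all)
  have eq0: "start f e + s = start f e' + f + 4 \<longleftrightarrow> e = Suc e' \<and> s = 0" for e'
    using start_inj[of s f 0 e "Suc e'"] s start_Suc[of f e'] by auto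
  have p: "proposal_of n f k (th k) (H F th r k) e' = proposal_of n f k (th k) (R F th k) e'"
    if "start f e' + 3 \<le> r" for e'
    by (rule proposal_of_cong; rule hist_at_le) (use that in simp_all)
  have ddr: "dout F th k (start f e + s) = prot_dec n f k (th k) (start f e + s) (H F th r k)"
    using dd r by simp
  show ?thesis
  proof (cases "s = 3")
    case True
    have "proposal n f (th k) (H F th r k) k = proposal_of n f k (th k) (R F th k) k" if "k = e"
      using p[of k] that r True by (simp add: proposal_of_def)
    moreover have "running n f k (H F th r k) e \<longleftrightarrow> running n f k (R F th k) e"
      by (rule running_H) (use r in simp)
    ultimately show ?thesis
      unfolding r ddr eq3 eq0 prot_dec_def start_div[OF s] start_mod[OF s] Let_def verdict_def
      using True by (auto simp: r)
  next
    case False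
    note F3 = this
    show ?thesis
    proof (cases "s = 0 \<and> 0 < e")
      case True
      then obtain e' where e': "e = Suc e'" by (cases e) auto
      have l: "start f e' + f + 4 = r" using e' r True start_Suc[of f e'] by simp
      have "proposal_of n f k (th k) (H F th r k) e' = proposal_of n f k (th k) (R F th k) e'"
        using p[of e'] l by simp
      moreover have "running n f k (H F th r k) e' \<longleftrightarrow> running n f k (R F th k) e'"
        by (rule running_H) (use l in simp)
      moreover have "lbad n f k (H F th r k) e' (Suc f) \<longleftrightarrow> lbad n f k (R F th k) e' (Suc f)"
        by (rule lbad_H) (use l in simp)
      ultimately show ?thesis
        unfolding r ddr eq3 eq0 prot_dec_def start_div[OF s] start_mod[OF s] Let_def verdict_def
        using True e' by (auto simp: r simp del: lbad.simps)
    next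
      case False
      hence "\<not> (e = Suc e' \<and> s = 0)" for e' by auto
      thus ?thesis
        unfolding r ddr eq3 eq0 prot_dec_def start_div[OF s] start_mod[OF s] Let_def
        using F3 False by (auto simp del: lbad.simps)
    qed
  qed
qed

text \<open>The observer still has its decision before it: the epochs before \<open>e\<close> have
  failed, so none of them made it decide, and what it sees in epoch \<open>e\<close> can influence
  the verdict.\<close>

lemma no_early_decision:
  assumes ex: "exact T" and adm: "admissible n f F" and ty: "types_ok n th" and a: "act n f F e"
    and k: "k < n" "k \<notin> C" and al: "alive n F k (start f e)" and T: "start f e \<le> T"
    and d: "dout F th k r \<noteq> None"
  shows "start f e + 3 \<le> r" "k \<noteq> e \<Longrightarrow> start f e + f + 4 \<le> r"
proof -
  obtain e' where e': "running n f k (R F th k) e'"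
    "r = start f e' + 3 \<and> k = e' \<or> r = start f e' + f + 4 \<and> \<not> lbad n f k (R F th k) e' (Suc f)"
    using d dout_iff[OF k(2)] by blast
  have "e \<le> e'"
  proof (rule ccontr)
    assume "\<not> e \<le> e'"
    hence lt: "e' < e" by simp
    have "running n f k (R F th k) e" by (rule sync_running[OF ex adm ty a k al T])
    hence "lbad n f k (R F th k) e' (Suc f)" using lt unfolding running_def by blast
    moreover have "e' \<noteq> k" by (rule act_neq[OF a lt al])
    ultimately show False using e' by blast
  qed
  hence c: "e' = e \<or> start f e + f + 4 \<le> start f e'" using start_less[of e e' f] by linarith
  show "start f e + 3 \<le> r" using c e'(2) by auto
  show "start f e + f + 4 \<le> r" if "k \<noteq> e" using c e'(2) that by auto
qed

text \<open>Extends \<open>pres\<close> to honest senders. For the round in question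
  \<open>pres\<close> is a separate hypothesis, since in the induction over rounds it is available
  before \<open>exact\<close> reaches that round.\<close>

lemma present_any:
  assumes ex: "exact T" and adm: "admissible n f F" and ty: "types_ok n th" and a: "act n f F e"
    and k: "k \<notin> C" "k \<noteq> e" and al: "alive n F k (start f e + 3 + q)" and q: "q \<le> f"
    and T: "start f e \<le> T" and pr: "pres (start f e + 4 + q)" and m: "(y, k, start f e + 4 + q) \<in> F"
  shows "R F th k (start f e + 4 + q) y \<noteq> None"
proof (cases "y \<in> C")
  case True
  have "alive n F k (start f e + 4 + q - 1)" using al by (simp add: eval_nat_numeral)
  thus ?thesis using pr adm ty a True k m q unfolding pres_def by blast
next
  case False
  have fp: "fp_ok n F" using adm by (simp add: admissible_iff)
  have "running n f y (R F th y) e"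
    by (rule sync_running[OF ex adm ty a fp_okD(1)[OF fp m] False alive_mono[OF fp_okD(4)[OF fp m]] T]) simp
  from msg_status[OF False this q, of k] fp_okD(1)[OF fp m] m show ?thesis by simp
qed

lemma flag_any:
  assumes ex: "exact T" and adm: "admissible n f F" and ty: "types_ok n th" and a: "act n f F e"
    and k: "k \<notin> C" "k \<noteq> e" and al: "alive n F k (start f e + 3 + q)" and q: "q \<le> f"
    and T: "start f e + 4 + q \<le> T" and m: "(y, k, start f e + 4 + q) \<in> F"
  shows "R F th k (start f e + 4 + q) y = Some 0 \<longleftrightarrow> fbad n f F e q y"
proof (cases "y \<in> C")
  case True
  have "alive n F k (start f e + 4 + q - 1)" using al by (simp add: eval_nat_numeral)
  moreover have "flag (start f e + 4 + q)" using ex T unfolding exact_def by blast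
  ultimately show ?thesis using adm ty a True k m q unfolding flag_def by blast
next
  case False
  have fp: "fp_ok n F" using adm by (simp add: admissible_iff)
  note y = fp_okD[OF fp m]
  have ay: "alive n F y (start f e + 3 + q)" using y(4) by (simp add: eval_nat_numeral)
  have r: "running n f y (R F th y) e"
    by (rule sync_running[OF ex adm ty a y(1) False]) (use alive_mono[OF ay] T in auto)
  have "lbad n f y (R F th y) e q \<longleftrightarrow> fbad n f F e q y"
    by (rule sync_status[OF ex adm ty a y(1) False _ ay]) (use q T in auto)
  thus ?thesis using msg_status[OF False r q, of k] y(1) m by (simp add: status_def)
qed

end

section \<open>Legal deviations and the exposure of missing messages\<close>

locale legal_deviation = deviation n f C s'
  for n f :: nat and C :: "nat set" and s' :: "'v::finite jprofile" +
  assumes fn: "f + 2 \<le> n"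
    and leg: "legal n f (deviate (prot n f) C s')"
    and indep: "\<And>i th th'. i \<in> C \<Longrightarrow> (\<forall>j\<in>C. th j = th' j) \<Longrightarrow> s' i th = s' i th'"
    and C_small: "card C \<le> 2" and C_n: "C \<subseteq> {..<n}"
    and V_large: "card (UNIV :: 'v set) \<ge> 2"
begin

lemma consensus: "admissible n f F \<Longrightarrow> types_ok n th \<Longrightarrow> consensus_run n F th (behaviour th)"
  using leg unfolding legal_def by blast

text \<open>A correct agent has to decide by termination; if every decision open to it is
  \<open>Top\<close>, validity is violated.\<close>

lemma always_alarm_illegal:
  assumes adm: "admissible n f F" and ty: "types_ok n th" and k: "k < n" "k \<notin> C" and c: "correct n F k"
    and al: "\<And>r. dout F th k r \<noteq> None \<Longrightarrow> alarm n f k (th k) (H F th r k) r"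
  shows False
proof -
  have cr: "consensus_run n F th (behaviour th)" using consensus adm ty by blast
  hence "decision n F (behaviour th) k \<noteq> None" using k c unfolding consensus_run_def by blast
  define r where "r = (LEAST r. decides_at n F (behaviour th) k r)"
  have "\<exists>r. decides_at n F (behaviour th) k r"
    by (rule ccontr) (use \<open>decision n F (behaviour th) k \<noteq> None\<close> in \<open>simp add: decision_def\<close>)
  hence r: "decision n F (behaviour th) k = dout F th k r" unfolding decision_def r_def by (rule if_P)
  hence r2: "dout F th k r \<noteq> None" using \<open>decision n F (behaviour th) k \<noteq> None\<close> by simp
  then obtain d where d: "dout F th k r = Some d" by blast
  hence "d = Top" using dout_iff[OF k(2)] al[OF r2] unfolding verdict_def by auto
  hence "decision n F (behaviour th) k = Some Top" using r d by simp
  thus False using cr k unfolding consensus_run_def by blast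
qed

text \<open>An agent other than the coordinator decides at the end of epoch \<open>e\<close> at the
  earliest, when it has seen the whole flooding.\<close>

lemma late_alarm_illegal:
  assumes ex: "exact T" and adm: "admissible n f F" and ty: "types_ok n th" and a: "act n f F e"
    and k: "k < n" "k \<notin> C" "k \<noteq> e" and c: "correct n F k" and T: "start f e \<le> T"
    and al: "\<And>r. start f e + 4 + f \<le> r \<Longrightarrow> alarm n f k (th k) (H F th r k) r"
  shows False
proof (rule always_alarm_illegal[OF adm ty k(1,2) c])
  fix r assume "dout F th k r \<noteq> None"
  hence "start f e + f + 4 \<le> r"
    using no_early_decision(2)[OF ex adm ty a k(1,2) _ T _ k(3)] c unfolding correct_iff_alive by blast
  thus "alarm n f k (th k) (H F th r k) r" using al by simp
qed

text \<open>A missing message to \<open>k\<close> is exposed when \<open>f\<close> agents other than \<open>j\<close> and \<open>k\<close> crash at the same time.\<close>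

lemma pres_step:
  assumes ex: "exact T"
  shows "pres (Suc T)"
  unfolding pres_def
proof (intro allI impI notI)
  fix F th j k e
  assume adm: "admissible n f F" and ty: "types_ok n th" and a: "act n f F e" and j: "j \<in> C" and k: "k \<notin> C"
    and alk: "alive n F k (Suc T - 1)" and m: "(j, k, Suc T) \<in> F"
    and t: "Suc T = start f e + 1 \<or> Suc T = start f e + 3 \<and> j = e \<or> (\<exists>q\<le>f. Suc T = start f e + 4 + q \<and> k \<noteq> e)"
    and none: "R F th k (Suc T) j = None"
  have fp: "fp_ok n F" using adm by (simp add: admissible_iff)
  note jk = fp_okD[OF fp m]
  have jT: "alive n F j T" and kT: "alive n F k T" using jk alk by auto
  have jkne: "j \<noteq> k" using j k by blast
  have eT: "start f e \<le> T" using t by auto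
  \<comment> \<open>\<open>Z\<close> has to contain everybody who has crashed by time
    \<open>T\<close>, to have exactly \<open>f\<close> elements and to avoid \<open>j\<close> and
    \<open>k\<close>; here \<open>f \<le> n - 2\<close> enters.\<close>
  define N where "N = {y. y < n \<and> \<not> alive n F y T}"
  have "N \<subseteq> {..<n} - {j, k}" unfolding N_def using jT kT by auto
  moreover have "card N \<le> f" by (rule faulty_card_le[OF adm]) (auto simp: N_def intro: faultyI)
  moreover have "f \<le> card ({..<n} - {j, k})" using jk jkne fn by (simp add: card_Diff_subset)
  ultimately obtain Z where Z: "N \<subseteq> Z" "Z \<subseteq> {..<n} - {j, k}" "card Z = f"
    using exists_subset_between[of N f "{..<n} - {j, k}"] by auto
  have fZ: "finite Z" using Z(2) finite_subset by blast
  define F' where "F' = {(y, x, r). if r \<le> T then (y, x, r) \<in> F else y \<notin> Z \<and> y < n \<and> x < n}"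
  have same: "(y, x, r) \<in> F' \<longleftrightarrow> (y, x, r) \<in> F" if "r \<le> T" for y x r using that unfolding F'_def by simp
  have alZ: "alive n F' y r" if "y \<notin> Z" "y < n" for y r
  proof -
    have "alive n F y T" using that Z(1) unfolding N_def by blast
    thus ?thesis using that unfolding alive_def F'_def by auto
  qed
  have fp': "fp_ok n F'"
  proof (rule fp_okI)
    fix y x r assume i: "(y, x, r) \<in> F'"
    show "y < n \<and> x < n \<and> 1 \<le> r \<and> alive n F' y (r - 1)"
    proof (cases "r \<le> T")
      case True
      hence "alive n F' y (r - 1) \<longleftrightarrow> alive n F y (r - 1)" by (intro alive_cong) (use same in auto)
      thus ?thesis using fp_okD[OF fp, of y x r] i same[OF True] by blast
    next
      case False
      thus ?thesis using i alZ unfolding F'_def by auto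
    qed
  qed
  have adm': "admissible n f F'"
  proof (rule admissibleI[OF fp' _ fZ])
    show "faulty n F' \<subseteq> Z" unfolding faulty_def correct_iff_alive using alZ by blast
  qed (use Z in simp)
  have ck: "correct n F' k" unfolding correct_iff_alive using alZ jk(2) Z(2) by blast
  have act': "act n f F' e" using a act_cong[of f e F F' n] same eT by auto
  have HT: "H F' th T x = H F th T x" for x by (rule hist_at_rounds_cong) (use same in auto)
  have "(j, k, Suc T) \<in> F'" unfolding F'_def using jk Z by auto
  hence nj: "R F' th k (Suc T) j = None" using none m HT by (simp add: R_at[of "Suc T" T] jk(1))
  have nZ: "R F' th k r y = None" if "y \<in> Z" "T < r" for y r
    using that unfolding rcv_def F'_def by simp
  have ak: "alive n F' k (start f e)" using ck unfolding correct_iff_alive by blast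
  have card: "f < card (insert j Z)" using Z fZ by (subst card_insert_disjoint) auto
  show False
  proof (rule always_alarm_illegal[OF adm' ty jk(2) k ck])
    fix r assume d: "dout F' th k r \<noteq> None"
    note r = no_early_decision[OF ex adm' ty act' jk(2) k ak eT d]
    have "insert j Z \<subseteq> suspects n f (H F' th r k) r"
    proof
      fix y assume y: "y \<in> insert j Z"
      have yn: "y < n" using y jk Z by auto
      have ny: "R F' th k (Suc T) y = None" using y nj nZ by blast
      consider "Suc T = start f e + 1" | "Suc T = start f e + 3" "j = e" | q where "q \<le> f" "Suc T = start f e + 4 + q" "k \<noteq> e"
        using t by blast
      thus "y \<in> suspects n f (H F' th r k) r"
      proof cases
        case 1
        show ?thesis by (rule suspects_ping[OF yn, of e]) (use 1 ny r in simp_all)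
      next
        case 2
        hence rr: "start f e + f + 4 \<le> r" using r jkne by blast
        show ?thesis
        proof (cases "y = j")
          case True
          have "e < n" "R F' th k (start f e + 3) e = None" using nj jk(1) 2 by metis+
          from suspects_proposal[OF this(1) r(1) this(2)] show ?thesis using True 2 by simp
        next
          case False
          \<comment> \<open>In the proposal round only \<open>e\<close> is expected to speak, so the
            other agents of \<open>Z\<close> become suspects in the flooding round that
            follows.\<close>
          hence "R F' th k (start f e + 4 + 0) y = None" using nZ[of y] y 2 by auto
          from suspects_status[OF yn _ _ this] show ?thesis using rr by simp
        qed
      next
        case 3
        have "R F' th k (start f e + 4 + q) y = None" using ny 3 by metis
        from suspects_status[OF yn 3(1) _ this] show ?thesis using 3 r by simp
      qed
    qed
    thus "alarm n f k (th k) (H F' th r k) r" by (rule alarm_suspects[OF card])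
  qed
qed

end

section \<open>Runs that a colluder cannot distinguish\<close>

context deviation
begin

text \<open>\<open>F'\<close> completes the broadcast of \<open>e\<close>. A colluder that is not
  bad has heard only from agents that are not bad, and these have the proposal in \<open>F\<close>
  as well, so the completion leaves no trace in its history. Honest agents may receive different
  messages during the flooding, but those heard by such a colluder send the same status in both
  runs.\<close>

lemma flood_eq:
  assumes ex: "exact T" and adm: "admissible n f F" and adm': "admissible n f F'" and ty: "types_ok n th"
    and a: "act n f F e"
    and pre: "\<And>y x r. r \<le> start f e + 2 \<Longrightarrow> (y, x, r) \<in> F' \<longleftrightarrow> (y, x, r) \<in> F"
    and d: "\<And>y x. y \<noteq> e \<Longrightarrow> (y, x, start f e + 3) \<in> F' \<longleftrightarrow> (y, x, start f e + 3) \<in> F"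
    and de: "\<And>x. x < n \<Longrightarrow> (e, x, start f e + 3) \<in> F'"
    and fl: "\<And>y x r. x \<in> C \<Longrightarrow> start f e + 3 < r \<Longrightarrow> r \<le> T \<Longrightarrow> (y, x, r) \<in> F' \<longleftrightarrow> (y, x, r) \<in> F"
  shows "start f e + 3 + q \<le> T \<Longrightarrow> q \<le> Suc f \<Longrightarrow> x \<in> C \<Longrightarrow> x < n \<Longrightarrow> alive n F x (start f e + 3 + q) \<Longrightarrow>
    \<not> fbad n f F e q x \<Longrightarrow> H F' th (start f e + 3 + q) x = H F th (start f e + 3 + q) x"
proof (induction q arbitrary: x)
  case 0
  have pre_eq: "H F' th (start f e + 2) y = H F th (start f e + 2) y" for y
    by (rule hist_at_rounds_cong) (rule pre)
  have "H F' th (Suc (start f e + 2)) x = H F th (Suc (start f e + 2)) x"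
  proof (rule hist_at_eqI[OF pre_eq])
    fix j assume j: "j < n"
    have "(j, x, start f e + 3) \<in> F' \<longleftrightarrow> (j, x, start f e + 3) \<in> F"
    proof (cases "j = e")
      case True
      have "(e, x, start f e + 3) \<in> F"
      proof (cases "x = e")
        case True
        thus ?thesis using aliveD[OF 0(5,4), of "start f e + 3"] 0 by simp
      next
        case False
        thus ?thesis using 0 by simp
      qed
      thus ?thesis using de 0 True by simp
    qed (use d in simp)
    moreover have "Suc (start f e + 2) = start f e + 3" by simp
    ultimately show "R F' th x (Suc (start f e + 2)) j = R F th x (Suc (start f e + 2)) j"
      unfolding rcv_def diff_Suc_1 pre_eq by (simp only:)
  qed
  thus ?case by (simp add: eval_nat_numeral)
next
  case (Suc q)
  have fp: "fp_ok n F" and fp': "fp_ok n F'" using adm adm' by (simp_all add: admissible_iff)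
  have a': "act n f F' e" using a act_cong[of f e F F' n] pre by auto
  have pre_eq: "H F' th (start f e + 2) y = H F th (start f e + 2) y" for y
    by (rule hist_at_rounds_cong) (rule pre)
  have ax: "alive n F x (start f e + 3 + q)" by (rule alive_mono[OF Suc.prems(5)]) simp
  have nx: "\<not> fbad n f F e q x" using Suc.prems by auto
  have IH: "H F' th (start f e + 3 + q) y = H F th (start f e + 3 + q) y"
    if "y \<in> C" "y < n" "alive n F y (start f e + 3 + q)" "\<not> fbad n f F e q y" for y
    using Suc.IH[of y] Suc.prems that by simp
  have "H F' th (Suc (start f e + 3 + q)) x = H F th (Suc (start f e + 3 + q)) x"
  proof (rule hist_at_eqI)
    show "H F' th (start f e + 3 + q) x = H F th (start f e + 3 + q) x"
      using IH Suc.prems ax nx by blast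
    fix y assume y: "y < n"
    let ?t = "start f e + 4 + q"
    have t: "Suc (start f e + 3 + q) = ?t" by (simp add: eval_nat_numeral)
    have same: "(y, x, ?t) \<in> F' \<longleftrightarrow> (y, x, ?t) \<in> F" by (rule fl) (use Suc.prems in auto)
    show "R F' th x (Suc (start f e + 3 + q)) y = R F th x (Suc (start f e + 3 + q)) y"
      unfolding t
    proof (cases "(y, x, ?t) \<in> F")
      case False
      thus "R F' th x ?t y = R F th x ?t y" using same by (simp add: rcv_def)
    next
      case True
      have ay: "alive n F y (start f e + 3 + q)" using fp_okD(4)[OF fp True] by (simp add: eval_nat_numeral)
      have ay': "alive n F' y (start f e + 3 + q)" using fp_okD(4)[OF fp', of y x ?t] True same by (simp add: eval_nat_numeral)
      \<comment> \<open>The coordinator is never bad, whatever it hears; but if it is alive now, its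
        broadcast was complete already in \<open>F\<close>.\<close>
      have ny: "\<not> fbad n f F e q y"
      proof (cases "x = e")
        case True
        have "(e, z, start f e + 3) \<in> F" if "z < n" for z
          using aliveD[OF ax that, of "start f e + 3"] True by simp
        thus ?thesis using fbad_none y by blast
      next
        case False
        thus ?thesis using Suc.prems(6) True y by auto
      qed
      show "R F' th x ?t y = R F th x ?t y"
      proof (cases "y \<in> C")
        case yC: True
        show ?thesis using IH[OF yC y ay ny] True same R_at[OF t[symmetric]] by simp
      next
        case yC: False
        have T: "start f e + 3 + q \<le> T" "q \<le> f" using Suc.prems by simp_all
        have r: "running n f y (R F th y) e"
          by (rule sync_running[OF ex adm ty a y yC alive_mono[OF ay]]) (use T in auto)
        have r': "running n f y (R F' th y) e"
          by (rule sync_running[OF ex adm' ty a' y yC alive_mono[OF ay']]) (use T in auto)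
        have "\<not> lbad n f y (R F th y) e q"
          using sync_status[OF ex adm ty a y yC _ ay T(1)] T ny by simp
        moreover have "\<not> lbad n f y (R F' th y) e q"
          using sync_status[OF ex adm' ty a' y yC _ ay' T(1)] T fbad_none[OF de y] by simp
        moreover have "proposal_of n f y (th y) (R F' th y) e = proposal_of n f y (th y) (R F th y) e"
        proof (cases "y = e")
          case True
          have "R F' th y (start f e + 2) = R F th y (start f e + 2)"
            by (rule R_rounds_cong[of "start f e + 2"]) (rule pre, assumption, rule order_refl)
          hence "proposal n f (th y) (R F' th y) e = proposal n f (th y) (R F th y) e" by (rule proposal_cong)
          thus ?thesis using True by (simp add: proposal_of_def)
        next
          case False
          have ey: "(e, y, start f e + 3) \<in> F" using fbad_mono[of n f F e 0 y q] ny False by auto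
          have t3: "start f e + 3 = Suc (start f e + 2)" by simp
          have "R F' th y (start f e + 3) e = R F th y (start f e + 3) e"
            unfolding R_at[OF t3] pre_eq by (simp only: ey de[OF y])
          thus ?thesis using False by (simp add: proposal_of_def)
        qed
        ultimately show ?thesis
          using msg_status[OF yC r T(2), of x] msg_status[OF yC r' T(2), of x] same by (simp add: status_def)
      qed
    qed
  qed
  thus ?case by (simp add: eval_nat_numeral)
qed

text \<open>Before the flooding of epoch \<open>e\<close>, colluders other than \<open>e\<close> only hear pings and the coordinator.\<close>

lemma token_eq:
  assumes j: "j \<in> C" "j \<noteq> e" and e1: "(e, j, start f e + 3) \<notin> F" and e2: "(e, j, start f e + 3) \<notin> F'"
    and b: "\<And>i. i \<in> C \<Longrightarrow> behaviour th i = behaviour th' i"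
    and h: "\<And>x. H F th (start f e) x = H F' th' (start f e) x"
    and p: "\<And>y x. x \<in> C \<Longrightarrow> (y, x, start f e + 1) \<in> F \<longleftrightarrow> (y, x, start f e + 1) \<in> F'"
    and c: "\<And>y x. x \<in> C \<Longrightarrow> y \<in> C \<Longrightarrow> (y, x, start f e + 2) \<in> F \<longleftrightarrow> (y, x, start f e + 2) \<in> F'"
    and d: "\<And>y. y \<in> C \<Longrightarrow> y \<noteq> e \<Longrightarrow> (y, j, start f e + 3) \<in> F \<longleftrightarrow> (y, j, start f e + 3) \<in> F'"
  shows "H F th (start f e + 3) j = H F' th' (start f e + 3) j"
proof -
  let ?s = "start f e"
  have r: "running n f y (R F th y) e \<longleftrightarrow> running n f y (R F' th' y) e" for y
    using running_H[of e ?s y F th] running_H[of e ?s y F' th'] h by simp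
  have 1: "H F th (Suc ?s) x = H F' th' (Suc ?s) x" if x: "x \<in> C" for x
  proof (rule hist_at_eqI[OF h])
    fix y assume y: "y < n"
    have s: "(y, x, Suc ?s) \<in> F \<longleftrightarrow> (y, x, Suc ?s) \<in> F'" using p[OF x] by simp
    show "R F th x (Suc ?s) y = R F' th' x (Suc ?s) y"
    proof (cases "y \<in> C")
      case True
      thus ?thesis using s b[OF True] h by (simp add: rcv_def)
    next
      case False
      show ?thesis using R_honest[OF False, of 0 "Suc ?s" e] s r by simp
    qed
  qed
  have 2: "H F th (Suc (Suc ?s)) x = H F' th' (Suc (Suc ?s)) x" if x: "x \<in> C" "x \<noteq> e" for x
  proof (rule hist_at_eqI[OF 1[OF x(1)]])
    fix y assume y: "y < n"
    show "R F th x (Suc (Suc ?s)) y = R F' th' x (Suc (Suc ?s)) y"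
    proof (cases "y \<in> C")
      case True
      thus ?thesis using c[OF x(1) True] b[OF True] 1[OF True] by (simp add: rcv_def)
    next
      case False
      show ?thesis using msg_report_None[OF False x(2)] by simp
    qed
  qed
  have "H F th (Suc (Suc (Suc ?s))) j = H F' th' (Suc (Suc (Suc ?s))) j"
  proof (rule hist_at_eqI[OF 2[OF j]])
    fix y assume y: "y < n"
    have t: "Suc (Suc (Suc ?s)) = ?s + 3" by simp
    show "R F th j (Suc (Suc (Suc ?s))) y = R F' th' j (Suc (Suc (Suc ?s))) y"
    proof (cases "y \<in> C")
      case True
      show ?thesis
      proof (cases "y = e")
        case True
        thus ?thesis using e1 e2 by (simp add: rcv_def t)
      next
        case False
        thus ?thesis using d[OF True False] b[OF True] 2[OF True False] unfolding rcv_def t by simp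
      qed
    next
      case False
      show ?thesis
      proof (cases "y = e")
        case True
        thus ?thesis using e1 e2 by (simp add: rcv_def t)
      next
        case ye: False
        show ?thesis using msg_proposal_None[OF False ye] unfolding t by simp
      qed
    qed
  qed
  thus ?thesis by (simp add: eval_nat_numeral)
qed

end

section \<open>Secrecy of favourite values\<close>

lemma prot_msg_secret:
  fixes \<theta> \<theta>' :: "('v::finite \<times> 'v) set"
  assumes "s < f + 4" "i \<noteq> e"
    and "s = 1 \<Longrightarrow> Suc (card {z. z < n \<and> z \<noteq> e \<and> h (start f e + 1) z = None}) < f"
  shows "prot_msg n f i \<theta> (start f e + s) h = prot_msg n f i \<theta>' (start f e + s) h"
  using assms(2,3)
  unfolding prot_msg_def Let_def start_div[OF assms(1)] start_mod[OF assms(1)]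
  by (auto simp: report_def status_def proposal_of_def fun_eq_iff)

context legal_deviation
begin

lemma behaviour_indep:
  assumes "i \<in> C" "a \<notin> C"
  shows "behaviour th i = behaviour (th(a := \<theta>)) i"
proof -
  have "\<forall>j\<in>C. th j = (th(a := \<theta>)) j" using assms by auto
  from indep[OF assms(1) this] show ?thesis using assms(1) unfolding deviate_def by (simp only: if_True)
qed

lemma ping_None_iff:
  assumes ex: "exact T" and adm: "admissible n f F" and ty: "types_ok n th" and a: "act n f F e"
    and k: "k < n" "k \<notin> C" and al: "alive n F k (start f e)" and T: "start f e + 1 \<le> T" and z: "z < n"
  shows "R F th k (start f e + 1) z = None \<longleftrightarrow> (z, k, start f e + 1) \<notin> F"
proof (cases "(z, k, start f e + 1) \<in> F")
  case True
  have fp: "fp_ok n F" using adm by (simp add: admissible_iff)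
  show ?thesis
  proof (cases "z \<in> C")
    case zC: True
    have "pres (start f e + 1)" using ex T unfolding exact_def by blast
    moreover have "alive n F k (start f e + 1 - 1)" using al by simp
    ultimately show ?thesis unfolding pres_def using adm ty a zC k True by blast
  next
    case False
    have "alive n F z (start f e)" using fp_okD(4)[OF fp True] by simp
    hence "running n f z (R F th z) e"
      using sync_running[OF ex adm ty a z False] T by simp
    thus ?thesis using msg_ping[OF False] z True by simp
  qed
qed (simp add: rcv_def)

text \<open>The type of \<open>a\<close> is a secret as long as no report containing it was sent; a report
  containing it in a failed epoch would leave no room for the failure of \<open>b\<close>.\<close>

lemma secret:
  assumes ex: "exact T" and adm: "admissible n f F" and ty: "types_ok n th" and act: "act n f F e"
    and a: "a < n" "a \<notin> C" "alive n F a (start f e)"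
    and b: "b \<in> faulty n F" "alive n F b (start f e)" and T: "start f e \<le> T"
  shows "H F th (start f e) x = H F (th(a := \<theta>)) (start f e) x"
proof -
  let ?th = "th(a := \<theta>)"
  have en: "e \<le> n" using act_le[OF adm fn act] fn by simp
  have "t \<le> start f e \<Longrightarrow> H F th t x = H F ?th t x" for t x
  proof (induction t arbitrary: x)
    case (Suc t)
    obtain e' s where t: "t = start f e' + s" and s: "s < f + 4" by (rule start_cases)
    have e': "e' < e"
    proof (rule ccontr)
      assume "\<not> e' < e"
      hence "start f e \<le> start f e'" using start_less[of e e' f] by (cases "e = e'") auto
      thus False using Suc.prems t by simp
    qed
    have ae': "act n f F e'" using act e' unfolding act_def by auto
    have ane: "a \<noteq> e'" using act_neq[OF act e' a(3)] by simp
    have bne: "b \<noteq> e'" using act_neq[OF act e' b(2)] by simp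
    have l: "start f e' + f + 4 \<le> start f e" by (rule start_less[OF e'])
    have few: "Suc (card {z. z < n \<and> z \<noteq> e' \<and> H F th t a (start f e' + 1) z = None}) < f" if "s = 1"
    proof -
      have ts: "start f e' + 1 = t" using that t by simp
      have al: "alive n F a (start f e')" using alive_mono[OF a(3)] l by simp
      have "H F th t a (start f e' + 1) z = None \<longleftrightarrow> (z, a, start f e' + 1) \<notin> F" if "z < n" for z
        using ping_None_iff[OF ex adm ty ae' a(1,2) al _ that] l T ts by (simp add: hist_at_le)
      hence eq: "{z. z < n \<and> z \<noteq> e' \<and> H F th t a (start f e' + 1) z = None} =
          {z. z < n \<and> z \<noteq> e' \<and> (z, a, start f e' + 1) \<notin> F}" by auto
      let ?Z = "{z. z < n \<and> z \<noteq> e' \<and> (z, a, start f e' + 1) \<notin> F}"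
      \<comment> \<open>\<open>b\<close> is alive at the start of epoch \<open>e\<close>, so it
        differs from \<open>e'\<close> and its ping arrived. Together with \<open>e'\<close> this
        makes two failures beyond the missing pings, which keeps their number below the threshold of
        \<open>report\<close>.\<close>
      have "insert b (insert e' ?Z) \<subseteq> faulty n F"
        using b act_coord_faulty[OF act e' en] a(1) unfolding faulty_def correct_def by auto
      hence "card (insert b (insert e' ?Z)) \<le> f" by (rule faulty_card_le[OF adm])
      moreover have "(b, a, start f e' + 1) \<in> F" by (rule aliveD[OF b(2) a(1)]) (use l in auto)
      ultimately show ?thesis unfolding eq using bne by simp
    qed
    show ?case
    proof (rule hist_at_eqI)
      show "H F th t x = H F ?th t x" by (rule Suc.IH) (use Suc.prems in simp)
      fix y assume y: "y < n"
      have hy: "H F ?th t y = H F th t y" by (rule Suc.IH[symmetric]) (use Suc.prems in simp)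
      have "fst (behaviour th y t (H F th t y)) = fst (behaviour ?th y t (H F th t y))"
      proof (cases "y \<in> C")
        case True
        thus ?thesis using behaviour_indep[OF True a(2)] by metis
      next
        case False
        show ?thesis
        proof (cases "y = a")
          case True
          have "prot_msg n f a (th a) t (H F th t a) = prot_msg n f a \<theta> t (H F th t a)"
            unfolding t by (rule prot_msg_secret[OF s ane]) (use few t in auto)
          thus ?thesis using False True by (simp add: deviate_def prot_def)
        qed (use False in \<open>simp add: deviate_def prot_def\<close>)
      qed
      thus "R F th x (Suc t) y = R F ?th x (Suc t) y" unfolding rcv_def using hy by simp
    qed
  qed simp
  thus ?thesis by simp
qed

end

section \<open>Forged proposals\<close>

lemma report_neq_ping:
  assumes "z < n" "h (start f e + 1) z = None \<longleftrightarrow> h' (start f e + 1) z \<noteq> None"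
  shows "report n f \<theta> h e \<noteq> report n f \<theta> h' e"
proof
  assume "report n f \<theta> h e = report n f \<theta> h' e"
  hence "map (\<lambda>z. h (start f e + 1) z = None) [0..<n] = map (\<lambda>z. h' (start f e + 1) z = None) [0..<n]"
    unfolding report_def by simp
  thus False using assms by (auto simp: map_eq_conv)
qed

lemma report_neq_top:
  assumes "top_of \<theta> \<noteq> top_of \<theta>'"
    and "f \<le> Suc (card {z. z < n \<and> z \<noteq> e \<and> h (start f e + 1) z = None})"
    and "f \<le> Suc (card {z. z < n \<and> z \<noteq> e \<and> h' (start f e + 1) z = None})"
  shows "report n f \<theta> h e \<noteq> report n f \<theta>' h' e"
  using assms unfolding report_def by simp

lemma proposal_neq_top: "top_of \<theta> \<noteq> top_of \<theta>' \<Longrightarrow> proposal n f \<theta> h e \<noteq> proposal n f \<theta>' h' e"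
  unfolding proposal_def by simp

text \<open>\<open>e\<close> has failed in round \<open>t\<close> or before, so it may lose one more
  message of round \<open>t\<close>.\<close>

lemma fp_ok_cut:
  assumes "fp_ok n F" "\<not> alive n F e t"
  shows "fp_ok n (F - {(e, k, t)})"
proof (rule fp_okI)
  fix i j r assume a: "(i, j, r) \<in> F - {(e, k, t)}"
  have d: "i < n" "j < n" "1 \<le> r" "alive n F i (r - 1)" using fp_okD[OF assms(1)] a by auto
  have "alive n (F - {(e, k, t)}) i (r - 1)"
    unfolding alive_def
  proof (intro allI impI)
    fix j' r' assume x: "j' < n" "1 \<le> r' \<and> r' \<le> r - 1"
    have "(i, j', r') \<noteq> (e, k, t)" using assms(2) alive_mono[OF d(4)] x by auto
    thus "(i, j', r') \<in> F - {(e, k, t)}" using aliveD[OF d(4)] x by auto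
  qed
  thus "i < n \<and> j < n \<and> 1 \<le> r \<and> alive n (F - {(e, k, t)}) i (r - 1)" using d by simp
qed

context legal_deviation
begin

lemma finite_C: "finite C"
  using C_n finite_subset by blast

lemma other_type:
  obtains \<theta> :: "('v \<times> 'v) set" where "is_type \<theta>" "top_of \<theta> \<noteq> a"
  using ex_type_other_top[OF V_large] by blast

lemma types_ok_upd: "types_ok n th \<Longrightarrow> is_type \<theta> \<Longrightarrow> types_ok n (th(a := \<theta>))"
  unfolding types_ok_def by simp

lemma forged_illegal:
  assumes ex: "exact T" and T: "start f e \<le> T" and adm: "admissible n f F" and ty: "types_ok n th" and a: "act n f F e"
    and k: "k < n" "k \<notin> C" "k \<noteq> e" and c: "correct n F k" and j: "j < n"
    and m: "R F th k (start f e + 4) j = Some (Suc w)"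
    and bad: "R F th k (start f e + 1) e = None
      \<or> snd (from_nat w :: 'v \<times> nat option list) ! k \<noteq> Some (report n f (th k) (R F th k) e)
      \<or> (\<exists>w'. w' \<noteq> w \<and> R F th k (start f e + 3) e = Some w')"
  shows False
  by (rule late_alarm_illegal[OF ex adm ty a k c T], rule alarm_forged[OF k(3)[symmetric] j m bad]) simp

text \<open>A single \<open>w\<close> cannot match two different reports or two different proposals,
  so one of the two runs raises an alarm. This is true of whatever \<open>w\<close> decodes to, even
  of a list too short for \<open>! k\<close>.\<close>

lemma two_runs_illegal:
  assumes ex: "exact T" and T: "start f e \<le> T"
    and adm: "admissible n f F" and ty: "types_ok n th" and a: "act n f F e" and c: "correct n F k"
    and adm': "admissible n f F'" and ty': "types_ok n th'" and a': "act n f F' e" and c': "correct n F' k"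
    and k: "k < n" "k \<notin> C" "k \<noteq> e" and j: "j < n"
    and m: "R F th k (start f e + 4) j = Some (Suc w)" and m': "R F' th' k (start f e + 4) j = Some (Suc w)"
    and bad: "report n f (th k) (R F th k) e \<noteq> report n f (th' k) (R F' th' k) e
      \<or> (\<exists>w w'. w' \<noteq> w \<and> R F th k (start f e + 3) e = Some w \<and> R F' th' k (start f e + 3) e = Some w')"
  shows False
  using forged_illegal[OF ex T adm ty a k c j m] forged_illegal[OF ex T adm' ty' a' k c' j m'] bad
  by (metis option.inject)

text \<open>The claim to have received a proposal that was not received. Only here \<open>card C \<le> 2\<close> is used: if the
  coordinator is a colluder, the agent \<open>z\<close> that may crash during the pings is honest.\<close>

lemma forged_status:
  assumes ex: "exact (start f e + 3)" and adm: "admissible n f F" and ty: "types_ok n th" and a: "act n f F e"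
    and j: "j \<in> C" and k: "k \<notin> C" "k \<noteq> e" and alk: "alive n F k (start f e + 3)"
    and m: "(j, k, start f e + 4) \<in> F" and bad: "fbad n f F e 0 j"
    and s: "R F th k (start f e + 4) j = Some (Suc w)"
  shows False
proof -
  let ?s = "start f e"
  have fp: "fp_ok n F" using adm by (simp add: admissible_iff)
  have jn: "j < n" and kn: "k < n" using fp_okD[OF fp m] by simp_all
  have alj: "alive n F j (?s + 3)" using fp_okD(4)[OF fp m] by (simp add: eval_nat_numeral)
  have je: "j \<noteq> e" and ej: "(e, j, ?s + 3) \<notin> F" using bad by simp_all
  have jk: "j \<noteq> k" using j k by blast
  have T: "?s \<le> ?s + 3" "?s + 1 \<le> ?s + 3" by simp_all
  have alk4: "alive n F k (?s + 4 - 1)" using alk by (simp add: add.commute)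
  have alj4: "alive n F j (?s + 4 - 1)" using alj by (simp add: add.commute)
  have same_msg: "R F' th' k (?s + 4) j = Some (Suc w)"
    if "H F th (?s + 3) j = H F' th' (?s + 3) j" "behaviour th j = behaviour th' j" "(j, k, ?s + 4) \<in> F'" for F' th'
    using s that m jn R_at[of "?s + 4" "?s + 3"] by simp
  have en: "e < n" using act_le[OF adm fn a] fn by simp
  show False
  proof (cases "alive n F e (?s + 1)")
    case False
    define F' where "F' = revive n k (?s + 4) (F - {(e, k, ?s + 1)})"
    have fp1: "fp_ok n (F - {(e, k, ?s + 1)})" by (rule fp_ok_cut[OF fp False])
    have alk1: "alive n (F - {(e, k, ?s + 1)}) k (?s + 4 - 1)" using alk4 k(2) unfolding alive_def by auto
    have fp': "fp_ok n F'" unfolding F'_def by (rule fp_ok_revive[OF fp1 alk1 kn]) simp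
    have ef: "e \<in> faulty n F" if "e < n" using that False by (rule faultyI)
    have "faulty n F' \<subseteq> faulty n F"
    proof
      fix y assume y: "y \<in> faulty n F'"
      show "y \<in> faulty n F"
      proof (cases "y = e")
        case True thus ?thesis using ef y unfolding faulty_def by simp
      next
        case False
        thus ?thesis using y unfolding faulty_def correct_def F'_def by auto
      qed
    qed
    hence adm': "admissible n f F'"
      by (rule admissibleI[OF fp' _ finite_faulty]) (use adm in \<open>simp add: admissible_iff\<close>)
    have sm: "(y, x, r) \<in> F' \<longleftrightarrow> (y, x, r) \<in> F" if "r < ?s + 4" "x \<noteq> k \<or> r \<noteq> ?s + 1" for y x r
      using that unfolding F'_def by auto
    have a': "act n f F' e" using a act_cong[of f e F F' n] sm by auto
    have smC: "(y, x, r) \<in> F' \<longleftrightarrow> (y, x, r) \<in> F" if "r < ?s + 4" "x \<in> C" for y x r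
    proof (rule sm[OF that(1)])
      show "x \<noteq> k \<or> r \<noteq> ?s + 1" using that(2) k(1) by blast
    qed
    have "H F th (?s + 3) j = H F' th (?s + 3) j"
    proof (rule token_eq[OF j je ej])
      show "(e, j, ?s + 3) \<notin> F'" using sm ej by simp
      show "H F th ?s x = H F' th ?s x" for x by (rule hist_at_rounds_cong) (use sm in simp)
    qed (use smC j in simp_all)
    hence m': "R F' th k (?s + 4) j = Some (Suc w)"
      by (rule same_msg) (use m in \<open>auto simp: F'_def\<close>)
    have "R F' th k (?s + 1) e = None" unfolding rcv_def F'_def using k(2) by simp
    thus False
      using forged_illegal[OF ex T(1) adm' ty a' kn k correct_revive[OF alk1, folded F'_def] jn m'] by blast
  next
    case ae: True
    have aes: "alive n F e ?s" by (rule alive_mono[OF ae]) simp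
    show False
    proof (cases "e \<in> C")
      case eC: False
      \<comment> \<open>\<open>e\<close> has to survive the report round in order to send its
        proposal to \<open>k\<close>, who can then compare. The copy for \<open>j\<close> remains
        missing, so \<open>e\<close> is faulty as before.\<close>
      define G where "G = F \<union> {(e, x, ?s + 2) | x. x < n} \<union> {(e, k, ?s + 3)}"
      define F' where "F' = revive n k (?s + 4) G"
      have FG: "F \<subseteq> G" "F \<subseteq> F'" unfolding G_def F'_def using subset_revive by blast+
      have fpG: "fp_ok n G"
      proof (rule fp_okI)
        fix i x r assume i: "(i, x, r) \<in> G"
        have e2: "alive n G e (?s + 2)"
          using alive_superset[OF ae FG(1)] unfolding alive_def G_def by (auto simp: le_Suc_eq numeral_2_eq_2)
        show "i < n \<and> x < n \<and> 1 \<le> r \<and> alive n G i (r - 1)"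
        proof (cases "(i, x, r) \<in> F")
          case True
          thus ?thesis using fp_okD[OF fp True] alive_superset[OF _ FG(1)] by blast
        next
          case False
          hence "i = e" "x < n" "r = ?s + 2 \<or> r = ?s + 3" using i kn unfolding G_def by auto
          thus ?thesis using en alive_mono[OF e2, of "r - 1"] by auto
        qed
      qed
      have alkG: "alive n G k (?s + 4 - 1)" by (rule alive_superset[OF alk4 FG(1)])
      have fp': "fp_ok n F'" unfolding F'_def by (rule fp_ok_revive[OF fpG alkG kn]) simp
      have adm': "admissible n f F'"
        by (rule admissibleI[OF fp' faulty_mono[OF FG(2)]]) (use adm in \<open>simp_all add: admissible_iff\<close>)
      have ck: "correct n F' k" unfolding F'_def by (rule correct_revive[OF alkG])
      have sm: "(y, x, r) \<in> F' \<longleftrightarrow> (y, x, r) \<in> F" if "r < ?s + 4" "y \<noteq> e \<or> r \<le> ?s + 1 \<or> (r = ?s + 3 \<and> x \<noteq> k)" for y x r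
        using that unfolding F'_def G_def by auto
      have a': "act n f F' e" using a act_cong[of f e F F' n] sm by auto
      obtain \<theta> :: "('v \<times> 'v) set" where \<theta>: "is_type \<theta>" "top_of \<theta> \<noteq> top_of (th e)" by (rule other_type)
      let ?th = "th(e := \<theta>)"
      have ty': "types_ok n ?th" by (rule types_ok_upd[OF ty \<theta>(1)])
      have ej': "(e, j, ?s + 3) \<notin> F'" using sm[of "?s + 3" e j] jk ej by simp
      have aes': "alive n F' e ?s" by (rule alive_superset[OF aes FG(2)])
      have ef: "e \<in> faulty n F'" by (rule undelivered_faulty[OF en jn _ ej']) simp
      have hs: "H F th ?s x = H F' th ?s x" for x by (rule hist_at_rounds_cong) (use sm in simp)
      have "H F' th ?s x = H F' ?th ?s x" for x
        by (rule secret[OF ex adm' ty a' en eC aes' ef aes' T(1)])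
      hence hs2: "H F th ?s x = H F' ?th ?s x" for x using hs by metis
      have mk: "(j, k, ?s + 4) \<in> F'" using m FG by blast
      have smp: "(y, x, ?s + 1) \<in> F \<longleftrightarrow> (y, x, ?s + 1) \<in> F'" if "x \<in> C" for y x
        by (rule sm[symmetric]) (use that k in auto)
      have smc: "(y, x, ?s + 2) \<in> F \<longleftrightarrow> (y, x, ?s + 2) \<in> F'" if "x \<in> C" "y \<in> C" for y x
        by (rule sm[symmetric]) (use that k eC j jk in auto)
      have smd: "(y, j, ?s + 3) \<in> F \<longleftrightarrow> (y, j, ?s + 3) \<in> F'" if "y \<in> C" "y \<noteq> e" for y
        by (rule sm[symmetric]) (use that k eC j jk in auto)
      have h1: "H F th (?s + 3) j = H F' th (?s + 3) j"
        by (rule token_eq[OF j je ej ej' refl hs smp smc smd])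
      have h2: "H F th (?s + 3) j = H F' ?th (?s + 3) j"
        by (rule token_eq[OF j je ej ej' behaviour_indep[OF _ eC] hs2 smp smc smd])
      have m1: "R F' th k (?s + 4) j = Some (Suc w)" by (rule same_msg[OF h1 _ mk]) simp
      have m2: "R F' ?th k (?s + 4) j = Some (Suc w)" by (rule same_msg[OF h2 behaviour_indep[OF j eC] mk])
      have ek: "(e, k, ?s + 3) \<in> F'" unfolding F'_def G_def by simp
      have r1: "R F' th k (?s + 3) e = Some (proposal n f (th e) (R F' th e) e)"
        using msg_proposal[OF eC sync_running[OF ex adm' ty a' en eC aes' T(1)]] ek en by simp
      have r2: "R F' ?th k (?s + 3) e = Some (proposal n f \<theta> (R F' ?th e) e)"
        using msg_proposal[OF eC sync_running[OF ex adm' ty' a' en eC aes' T(1)]] ek en by simp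
      show False
        by (rule two_runs_illegal[OF ex T(1) adm' ty a' ck adm' ty' a' ck kn k jn m1 m2])
          (use r1 r2 proposal_neq_top[OF \<theta>(2)] in blast)
    next
      case eC: True
      have Ceq: "C = {e, j}"
        using card_subset_eq[of C "{e, j}"] card_mono[of C "{e, j}"] finite_C C_small je eC j by force
      define Y where "Y = {y. y < n \<and> y \<noteq> e \<and> \<not> alive n F y ?s}"
      have efF: "e \<in> faulty n F" by (rule undelivered_faulty[OF en jn _ ej]) simp
      have finY: "finite Y" unfolding Y_def by simp
      have YF: "Y \<subseteq> faulty n F" unfolding Y_def by (auto intro: faultyI)
      show False
      \<comment> \<open>The threshold of \<open>report\<close>: the agents of \<open>Y\<close> send
        no ping in this epoch, so in the first case \<open>k\<close> discloses its favourite and the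
        secret is the type of \<open>k\<close>. In the second case the secret is whether
        \<open>k\<close> misses the ping of some \<open>z\<close>.\<close>
      proof (cases "f \<le> Suc (card Y)")
        case many: True
        define F' where "F' = revive n k (?s + 4) F"
        have adm': "admissible n f F'" unfolding F'_def by (rule adm_revive[OF adm alk4 kn]) simp
        have ck: "correct n F' k" unfolding F'_def by (rule correct_revive[OF alk4])
        have sm: "(y, x, r) \<in> F' \<longleftrightarrow> (y, x, r) \<in> F" if "r < ?s + 4" for y x r
          using that unfolding F'_def by auto
        have a': "act n f F' e" using a act_cong[of f e F F' n] sm by auto
        obtain \<theta> :: "('v \<times> 'v) set" where \<theta>: "is_type \<theta>" "top_of \<theta> \<noteq> top_of (th k)" by (rule other_type)
        let ?th = "th(k := \<theta>)"
        have ty': "types_ok n ?th" by (rule types_ok_upd[OF ty \<theta>(1)])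
        have ej': "(e, j, ?s + 3) \<notin> F'" using sm ej by simp
        have aes': "alive n F' e ?s" unfolding F'_def by (rule alive_superset[OF aes subset_revive])
        have aks': "alive n F' k ?s" using ck unfolding correct_iff_alive by blast
        have ef: "e \<in> faulty n F'" by (rule undelivered_faulty[OF en jn _ ej']) simp
        have hs: "H F th ?s x = H F' th ?s x" for x by (rule hist_at_rounds_cong) (use sm in simp)
        have "H F' th ?s x = H F' ?th ?s x" for x
          by (rule secret[OF ex adm' ty a' kn k(1) aks' ef aes' T(1)])
        hence hs2: "H F th ?s x = H F' ?th ?s x" for x using hs by metis
        have mk: "(j, k, ?s + 4) \<in> F'" using m unfolding F'_def by simp
        have smp: "(y, x, ?s + 1) \<in> F \<longleftrightarrow> (y, x, ?s + 1) \<in> F'" if "x \<in> C" for y x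
          by (rule sm[symmetric]) (use that k in auto)
        have smc: "(y, x, ?s + 2) \<in> F \<longleftrightarrow> (y, x, ?s + 2) \<in> F'" if "x \<in> C" "y \<in> C" for y x
          by (rule sm[symmetric]) (use that k in auto)
        have smd: "(y, j, ?s + 3) \<in> F \<longleftrightarrow> (y, j, ?s + 3) \<in> F'" if "y \<in> C" "y \<noteq> e" for y
          by (rule sm[symmetric]) (use that k in auto)
        have h1: "H F th (?s + 3) j = H F' th (?s + 3) j"
          by (rule token_eq[OF j je ej ej' refl hs smp smc smd])
        have h2: "H F th (?s + 3) j = H F' ?th (?s + 3) j"
          by (rule token_eq[OF j je ej ej' behaviour_indep[OF _ k(1)] hs2 smp smc smd])
        have m1: "R F' th k (?s + 4) j = Some (Suc w)" by (rule same_msg[OF h1 _ mk]) simp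
        have m2: "R F' ?th k (?s + 4) j = Some (Suc w)" by (rule same_msg[OF h2 behaviour_indep[OF j k(1)] mk])
        have reveal: "f \<le> Suc (card {z. z < n \<and> z \<noteq> e \<and> R F' th' k (?s + 1) z = None})" for th'
        proof -
          have "(y, k, ?s + 1) \<notin> F'" if "y \<in> Y" for y
            using that fp_okD(4)[OF fp, of y k "?s + 1"] sm unfolding Y_def by auto
          hence "Y \<subseteq> {z. z < n \<and> z \<noteq> e \<and> R F' th' k (?s + 1) z = None}"
            unfolding rcv_def Y_def by auto
          hence "card Y \<le> card {z. z < n \<and> z \<noteq> e \<and> R F' th' k (?s + 1) z = None}"
            by (rule card_mono[rotated]) simp
          thus ?thesis using many by simp
        qed
        have "report n f (?th k) (R F' ?th k) e \<noteq> report n f (th k) (R F' th k) e"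
          by (rule report_neq_top) (use \<theta>(2) reveal in simp_all)
        thus False
          using two_runs_illegal[OF ex T(1) adm' ty' a' ck adm' ty a' ck kn k jn m2 m1] by blast
      next
        case False
        hence few: "Suc (Suc (card Y)) \<le> f" by simp
        define G where "G = faulty n F - {j, k}"
        have cG: "card G \<le> f" by (rule faulty_card_le[OF adm]) (simp add: G_def)
        have finG: "finite G" unfolding G_def by simp
        \<comment> \<open>Either an agent that is faulty anyway crashes only after the start of the
          epoch, and its crash is advanced; or at most \<open>Suc (card Y) < f\<close> agents are in
          \<open>G\<close>, and \<open>card Y + 4 \<le> n\<close> leaves a fresh one.
          \<open>j\<close> and \<open>k\<close> do not count as failures because \<open>F'\<close>
          revives them.\<close>
        have "\<exists>z<n. z \<notin> Y \<and> z \<noteq> e \<and> z \<noteq> j \<and> z \<noteq> k \<and> card (insert z G) \<le> f"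
        proof (cases "\<exists>z\<in>G. z \<notin> insert e Y")
          case True
          then obtain z where z: "z \<in> G" "z \<notin> insert e Y" by blast
          hence "card (insert z G) \<le> f" using cG by (simp add: insert_absorb)
          moreover have "z < n" "z \<noteq> j" "z \<noteq> k" using z(1) unfolding G_def faulty_def by auto
          ultimately show ?thesis using z(2) by blast
        next
          case False
          hence "G \<subseteq> insert e Y" by blast
          hence "card G \<le> card (insert e Y)" using finY by (intro card_mono) auto
          also have "\<dots> \<le> Suc (card Y)" using finY by (simp add: card_insert_if)
          finally have "card G \<le> Suc (card Y)" .
          hence c: "card (insert z G) \<le> f" for z using few finG by (simp add: card_insert_if)
          have "card (insert e (insert j (insert k Y))) \<le> Suc (Suc (Suc (card Y)))"
            using finY by (simp add: card_insert_if)
          also have "\<dots> < card {..<n}" using few fn by simp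
          finally have "\<not> {..<n} \<subseteq> insert e (insert j (insert k Y))"
            using card_mono[of "insert e (insert j (insert k Y))" "{..<n}"] finY by auto
          thus ?thesis using c by auto
        qed
        then obtain z where z: "z < n" "z \<notin> Y" "z \<noteq> e" "z \<noteq> j" "z \<noteq> k" "card (insert z G) \<le> f" by blast
        have zC: "z \<notin> C" using z Ceq by simp
        have az: "alive n F z ?s" using z unfolding Y_def by blast
        \<comment> \<open>\<open>z\<close> falls silent after the ping round, and \<open>b\<close>
          decides about its ping to \<open>k\<close> alone. The colluders get the same pings as in
          \<open>F\<close>; all that an honest \<open>z\<close> could still send before the flooding
          is a report to \<open>e\<close>, from whom \<open>j\<close> hears nothing in the proposal
          round.\<close>
        define X where "X = (\<lambda>b. {(y, x, r). (y, x, r) \<in> F \<and> \<not> (y = z \<and> (?s + 1 < r \<or> ?s + 1 = r \<and> x = k)) \<or>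
            b \<and> y = z \<and> x = k \<and> r = ?s + 1})"
        define F' where "F' = (\<lambda>b. revive n k (?s + 4) (revive n j (?s + 4) (X b)))"
        have aX: "alive n (X b) y r \<longleftrightarrow> alive n F y r" if "y \<noteq> z \<or> r \<le> ?s" for b y r
          by (rule alive_cong) (use that in \<open>auto simp: X_def\<close>)
        have fpX: "fp_ok n (X b)" for b
        proof (rule fp_okI)
          fix y x r assume i: "(y, x, r) \<in> X b"
          show "y < n \<and> x < n \<and> 1 \<le> r \<and> alive n (X b) y (r - 1)"
          proof (cases "(y, x, r) \<in> F")
            case True
            have "y \<noteq> z \<or> r - 1 \<le> ?s" using i unfolding X_def by auto
            thus ?thesis using fp_okD[OF fp True] aX by blast
          next
            case False
            hence "y = z" "x = k" "r = ?s + 1" using i unfolding X_def by auto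
            thus ?thesis using z(1) kn az aX[of y "?s" b] by simp
          qed
        qed
        have alj': "alive n (X b) j (?s + 4 - 1)" for b using aX[of j _ b] alj4 z by blast
        have alk0: "alive n (X b) k (?s + 4 - 1)" for b using aX[of k _ b] alk4 z by blast
        have alk': "alive n (revive n j (?s + 4) (X b)) k (?s + 4 - 1)" for b
          by (rule alive_superset[OF alk0 subset_revive])
        have fp1: "fp_ok n (revive n j (?s + 4) (X b))" for b
          by (rule fp_ok_revive[OF fpX alj' jn]) simp
        have fp': "fp_ok n (F' b)" for b
          unfolding F'_def by (rule fp_ok_revive[OF fp1 alk' kn]) simp
        have ck: "correct n (F' b) k" for b unfolding F'_def by (rule correct_revive[OF alk'])
        have cj: "correct n (F' b) j" for b
        proof -
          have "correct n (revive n j (?s + 4) (X b)) j" by (rule correct_revive[OF alj'])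
          thus ?thesis unfolding F'_def correct_iff_alive using alive_superset[OF _ subset_revive] by blast
        qed
        have "faulty n (F' b) \<subseteq> insert z G" for b
        proof
          fix y assume y: "y \<in> faulty n (F' b)"
          have "y \<noteq> j" "y \<noteq> k" using y ck cj unfolding faulty_def by auto
          moreover have "y \<in> faulty n F" if "y \<noteq> z"
          proof (rule ccontr)
            assume "y \<notin> faulty n F"
            hence "alive n (X b) y r" for r using y aX that unfolding faulty_def correct_iff_alive by blast
            hence "alive n (F' b) y r" for r
              unfolding F'_def using alive_superset[OF alive_superset[OF _ subset_revive] subset_revive] by blast
            thus False using y unfolding faulty_def correct_iff_alive by blast
          qed
          ultimately show "y \<in> insert z G" unfolding G_def by blast
        qed
        hence adm': "admissible n f (F' b)" for b
          by (rule admissibleI[OF fp']) (use finG z in auto)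
        have sm: "(y, x, r) \<in> F' b \<longleftrightarrow> (y, x, r) \<in> F" if "r < ?s + 4" "r \<le> ?s \<or> y \<noteq> z \<or> r = ?s + 1 \<and> x \<noteq> k" for y x r b
          using that unfolding F'_def X_def by auto
        have a': "act n f (F' b) e" for b using a act_cong[of f e F "F' b" n] sm by auto
        have ej': "(e, j, ?s + 3) \<notin> F' b" for b using sm z ej by simp
        have hs: "H F th ?s x = H (F' b) th ?s x" for x b by (rule hist_at_rounds_cong) (use sm in simp)
        have mk: "(j, k, ?s + 4) \<in> F' b" for b using m z unfolding F'_def X_def by simp
        have smp: "(y, x, ?s + 1) \<in> F \<longleftrightarrow> (y, x, ?s + 1) \<in> F' b" if "x \<in> C" for y x b
          by (rule sm[symmetric]) (use that k in auto)
        have smc: "(y, x, ?s + 2) \<in> F \<longleftrightarrow> (y, x, ?s + 2) \<in> F' b" if "x \<in> C" "y \<in> C" for y x b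
          by (rule sm[symmetric]) (use that zC k in auto)
        have smd: "(y, j, ?s + 3) \<in> F \<longleftrightarrow> (y, j, ?s + 3) \<in> F' b" if "y \<in> C" "y \<noteq> e" for y b
          by (rule sm[symmetric]) (use that zC k in auto)
        have h1: "H F th (?s + 3) j = H (F' b) th (?s + 3) j" for b
          by (rule token_eq[OF j je ej ej' refl hs smp smc smd])
        have m1: "R (F' b) th k (?s + 4) j = Some (Suc w)" for b by (rule same_msg[OF h1 _ mk]) simp
        have "(z, k, ?s + 1) \<notin> F' False" unfolding F'_def X_def using z by simp
        hence n0: "R (F' False) th k (?s + 1) z = None" unfolding rcv_def by simp
        have az': "alive n (F' True) z ?s" using az alive_cong[of n ?s z F "F' True"] sm by auto
        have "(z, k, ?s + 1) \<in> F' True" unfolding F'_def X_def by simp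
        hence n1: "R (F' True) th k (?s + 1) z \<noteq> None"
          using msg_ping[OF zC sync_running[OF ex adm' ty a' z(1) zC az' T(1)]] z(1) by simp
        have "report n f (th k) (R (F' True) th k) e \<noteq> report n f (th k) (R (F' False) th k) e"
          by (rule report_neq_ping[OF z(1)]) (use n0 n1 in simp)
        thus False
          using two_runs_illegal[OF ex T(1) adm' ty a' ck adm' ty a' ck kn k jn m1 m1] by blast
      qed
    qed
  qed
qed

end

section \<open>False statuses and the induction over rounds\<close>

context legal_deviation
begin

text \<open>By \<open>flood_eq\<close>, an agent that is not bad cannot exclude that the broadcast
  was complete and that \<open>e\<close> even sent a status to \<open>k\<close>. In that run
  announcing a failure is exposed by \<open>late\<close>.\<close>

lemma late_zero_status:
  assumes ex: "exact (start f e + 3 + q)" and pr: "pres (start f e + 4 + q)"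
    and adm: "admissible n f F" and ty: "types_ok n th" and a: "act n f F e"
    and j: "j \<in> C" and k: "k \<notin> C" "k \<noteq> e" and alk: "alive n F k (start f e + 3 + q)" and q: "q \<le> f"
    and m: "(j, k, start f e + 4 + q) \<in> F" and good: "\<not> fbad n f F e q j"
    and s: "R F th k (start f e + 4 + q) j = Some 0"
  shows False
proof -
  let ?s = "start f e" and ?t = "start f e + 4 + q"
  have fp: "fp_ok n F" using adm by (simp add: admissible_iff)
  have jn: "j < n" and kn: "k < n" using fp_okD[OF fp m] by simp_all
  have alj: "alive n F j (?s + 3 + q)" using fp_okD(4)[OF fp m] by (simp add: eval_nat_numeral)
  have en: "e < n" using act_le[OF adm fn a] fn by simp
  have ej: "(e, j, ?s + 3) \<in> F"
  proof (cases "j = e")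
    case True
    thus ?thesis using aliveD[OF alj jn, of "?s + 3"] by simp
  next
    case False
    thus ?thesis using fbad_mono[of n f F e 0 j q] good by auto
  qed
  have ae: "alive n F e (?s + 2)" using fp_okD(4)[OF fp ej] by (simp add: eval_nat_numeral)
  define G where "G = F \<union> {(e, x, ?s + 3) | x. x < n} \<union> {(e, k, ?s + 4)}"
  define F' where "F' = revive n k ?t G"
  have FG1: "F \<subseteq> G" unfolding G_def by blast
  have "G \<subseteq> F'" unfolding F'_def by (rule subset_revive)
  with FG1 have FG: "F \<subseteq> G" "F \<subseteq> F'" by blast+
  have s3: "Suc (?s + 2) = ?s + 3" by simp
  have e3: "alive n G e (?s + 3)"
    using alive_extend[OF alive_superset[OF ae FG(1)]] unfolding s3 by (simp add: G_def)
  have fpG: "fp_ok n G"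
  proof (rule fp_okI)
    fix i x r assume i: "(i, x, r) \<in> G"
    show "i < n \<and> x < n \<and> 1 \<le> r \<and> alive n G i (r - 1)"
    proof (cases "(i, x, r) \<in> F")
      case True
      thus ?thesis using fp_okD[OF fp True] alive_superset[OF _ FG(1)] by blast
    next
      case False
      hence "i = e" "x < n" "r = ?s + 3 \<or> r = ?s + 4" using i kn unfolding G_def by auto
      thus ?thesis using en alive_mono[OF e3, of "r - 1"] by auto
    qed
  qed
  have t1: "?t - 1 = ?s + 3 + q" "?t = Suc (?s + 3 + q)" by simp_all
  have alkG: "alive n G k (?t - 1)" using alive_superset[OF alk FG(1)] unfolding t1(1) .
  have fp': "fp_ok n F'" unfolding F'_def by (rule fp_ok_revive[OF fpG alkG kn]) simp
  have adm': "admissible n f F'"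
    by (rule admissibleI[OF fp' faulty_mono[OF FG(2)]]) (use adm in \<open>simp_all add: admissible_iff\<close>)
  have ck: "correct n F' k" unfolding F'_def by (rule correct_revive[OF alkG])
  have sm: "(y, x, r) \<in> F' \<longleftrightarrow> (y, x, r) \<in> F" if "r < ?t" "y \<noteq> e \<or> r \<le> ?s + 2 \<or> (?s + 3 < r \<and> x \<noteq> k)" for y x r
    using that unfolding F'_def G_def by auto
  have a': "act n f F' e" using a act_cong[of f e F F' n] sm by auto
  have "H F' th (?s + 3 + q) j = H F th (?s + 3 + q) j"
  proof (rule flood_eq[OF ex adm adm' ty a])
    show "(y, x, r) \<in> F' \<longleftrightarrow> (y, x, r) \<in> F" if "r \<le> ?s + 2" for y x r
      by (rule sm) (use that in auto)
    show "(y, x, ?s + 3) \<in> F' \<longleftrightarrow> (y, x, ?s + 3) \<in> F" if "y \<noteq> e" for y x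
      by (rule sm) (use that in auto)
    show "(e, x, ?s + 3) \<in> F'" if "x < n" for x using that unfolding F'_def G_def by simp
    show "(y, x, r) \<in> F' \<longleftrightarrow> (y, x, r) \<in> F" if "x \<in> C" "?s + 3 < r" "r \<le> ?s + 3 + q" for y x r
      by (rule sm) (use that k in auto)
  qed (use j jn alj good q in auto)
  hence s': "R F' th k ?t j = Some 0"
    using s m FG(2) unfolding R_at[OF t1(2)] by (auto split: if_splits)
  have "R F' th k (?s + 4 + 0) e \<noteq> None"
  proof (rule present_any[OF ex adm' ty a' k])
    \<comment> \<open>For \<open>q = 0\<close> this is the current round, which \<open>ex\<close>
      does not cover yet.\<close>
    show "pres (?s + 4 + 0)"
    proof (cases q)
      case 0 thus ?thesis using pr by simp
    next
      case (Suc q') thus ?thesis using ex unfolding exact_def by simp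
    qed
    show "alive n F' k (?s + 3 + 0)" using ck unfolding correct_iff_alive by blast
    show "(e, k, ?s + 4 + 0) \<in> F'" unfolding F'_def G_def by simp
  qed simp_all
  hence "R F' th k (?s + 4) e \<noteq> None" by simp
  from alarm_late[OF k(2)[symmetric] jn q this s'] show False
    by (intro late_alarm_illegal[OF ex adm' ty a' kn k ck]) simp_all
qed

text \<open>Let \<open>y\<close> be the agent that made \<open>j\<close> bad. If \<open>y\<close> is
  revived from the round of its announcement on, \<open>k\<close> sees both the announcement and the
  survival of \<open>y\<close>, whereas \<open>j\<close>, who got the announcement anyway, sees no
  difference; then \<open>switched\<close> applies. If \<open>j\<close> was bad already,
  \<open>y = j\<close>.\<close>

lemma switched_status:
  assumes ex: "exact (start f e + 4 + q)" and pr: "pres (start f e + 5 + q)"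
    and adm: "admissible n f F" and ty: "types_ok n th" and a: "act n f F e"
    and j: "j \<in> C" and k: "k \<notin> C" "k \<noteq> e" and alk: "alive n F k (start f e + 4 + q)" and q: "q < f"
    and m: "(j, k, start f e + 5 + q) \<in> F" and bad: "fbad n f F e (Suc q) j"
    and s: "R F th k (start f e + 5 + q) j = Some (Suc w)"
  shows False
proof -
  let ?s = "start f e" and ?t = "start f e + 5 + q"
  have fp: "fp_ok n F" using adm by (simp add: admissible_iff)
  have jn: "j < n" and kn: "k < n" using fp_okD[OF fp m] by simp_all
  have t1: "?t - 1 = ?s + 4 + q" "?t = Suc (?s + 4 + q)" "?s + 4 + q = Suc (?s + 3 + q)" by simp_all
  have alj: "alive n F j (?s + 4 + q)" using fp_okD(4)[OF fp m] unfolding t1(1) .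
  have je: "j \<noteq> e" using bad fbad_coord by metis
  have jk: "j \<noteq> k" using j k by blast
  obtain y where y: "y < n" "fbad n f F e q y" "y = j \<or> (y, j, ?s + 4 + q) \<in> F"
    using bad jn by auto
  have yal: "alive n F y (?s + 3 + q)"
  proof (cases "y = j")
    case True
    thus ?thesis using alive_mono[OF alj] by simp
  next
    case False
    thus ?thesis using y fp_okD(4)[OF fp, of y j "?s + 4 + q"] unfolding t1(3) diff_Suc_1 by blast
  qed
  define G where "G = (if y = j then F else revive n y (?s + 4 + q) F)"
  define F' where "F' = revive n k ?t G"
  have FG1: "F \<subseteq> G" unfolding G_def using subset_revive by simp
  have FG2: "G \<subseteq> F'" unfolding F'_def by (rule subset_revive)
  with FG1 have FG: "F \<subseteq> G" "F \<subseteq> F'" "G \<subseteq> F'" by blast+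
  have yal1: "alive n F y (?s + 4 + q - 1)" using yal unfolding t1(3) diff_Suc_1 .
  have fpG: "fp_ok n G"
  proof (cases "y = j")
    case False
    have "fp_ok n (revive n y (?s + 4 + q) F)" by (rule fp_ok_revive[OF fp yal1 y(1)]) simp
    thus ?thesis unfolding G_def using False by simp
  qed (use fp in \<open>simp add: G_def\<close>)
  have alkG: "alive n G k (?t - 1)" using alive_superset[OF alk FG(1)] unfolding t1(1) .
  have fp': "fp_ok n F'" unfolding F'_def by (rule fp_ok_revive[OF fpG alkG kn]) simp
  have adm': "admissible n f F'"
    by (rule admissibleI[OF fp' faulty_mono[OF FG(2)]]) (use adm in \<open>simp_all add: admissible_iff\<close>)
  have ck: "correct n F' k" unfolding F'_def by (rule correct_revive[OF alkG])
  have sm: "(z, x, r) \<in> F' \<longleftrightarrow> (z, x, r) \<in> F" if "r \<le> ?s + 3 + q" for z x r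
    using that unfolding F'_def G_def by auto
  have a': "act n f F' e" using a act_cong[of f e F F' n] sm by auto
  have "H F' th (Suc (?s + 3 + q)) j = H F th (Suc (?s + 3 + q)) j"
  proof (rule hist_at_eqI)
    have h: "H F' th (?s + 3 + q) x = H F th (?s + 3 + q) x" for x
      by (rule hist_at_rounds_cong) (rule sm)
    show "H F' th (?s + 3 + q) j = H F th (?s + 3 + q) j" by (rule h)
    fix z assume "z < n"
    have "(z, j, ?s + 4 + q) \<in> F' \<longleftrightarrow> (z, j, ?s + 4 + q) \<in> F"
      using y unfolding F'_def G_def by auto
    thus "R F' th j (Suc (?s + 3 + q)) z = R F th j (Suc (?s + 3 + q)) z"
      unfolding rcv_def diff_Suc_1 h unfolding t1(3)[symmetric] by (simp only:)
  qed
  hence s': "R F' th k ?t j = Some (Suc w)"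
    using s m FG(2) unfolding R_at[OF t1(2)] t1(3) by (auto split: if_splits)
  have cka: "alive n F' k r" for r using ck unfolding correct_iff_alive by blast
  have yk: "(y, k, ?s + 4 + q) \<in> F'" "(y, k, ?t) \<in> F'"
  proof -
    show "(y, k, ?s + 4 + q) \<in> F'"
      using aliveD[OF alj kn, of "?s + 4 + q"] kn FG unfolding F'_def G_def by auto
    show "(y, k, ?t) \<in> F'" using m kn unfolding F'_def G_def by auto
  qed
  have "fbad n f F' e q y" using fbad_cong[of f e q F F' n y] sm y(2) by simp
  hence y0: "R F' th k (?s + 4 + q) y = Some 0"
    using flag_any[OF ex adm' ty a' k cka _ _ yk(1)] q by simp
  have yk2: "(y, k, ?s + 4 + Suc q) \<in> F'" using yk(2) by (simp add: eval_nat_numeral)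
  have pr2: "pres (?s + 4 + Suc q)" using pr by (simp add: eval_nat_numeral)
  have "R F' th k (?s + 4 + Suc q) y \<noteq> None"
    by (rule present_any[OF ex adm' ty a' k cka _ _ pr2 yk2]) (use q in simp_all)
  hence y1: "R F' th k ?t y \<noteq> None" by (simp add: eval_nat_numeral)
  from alarm_switch[OF k(2)[symmetric] jn y(1) q y0 y1 s'] show False
    by (intro late_alarm_illegal[OF ex adm' ty a' kn k ck]) simp_all
qed

lemma flag_step:
  assumes ex: "exact T" and pr: "pres (Suc T)"
  shows "flag (Suc T)"
  unfolding flag_def
proof (intro allI impI)
  fix F j k e q and th :: "nat \<Rightarrow> ('v \<times> 'v) set"
  assume adm: "admissible n f F" and ty: "types_ok n th" and a: "act n f F e" and j: "j \<in> C" and k: "k \<notin> C"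
    and alk: "alive n F k (Suc T - 1)" and m: "(j, k, Suc T) \<in> F"
    and q: "q \<le> f" and t: "Suc T = start f e + 4 + q" and ke: "k \<noteq> e"
  have T: "T = start f e + 3 + q" using t by simp
  have al: "alive n F k (start f e + 3 + q)" using alk unfolding diff_Suc_1 T .
  have ex': "exact (start f e + 3 + q)" using ex T by simp
  have pr': "pres (start f e + 4 + q)" using pr t by metis
  have m': "(j, k, start f e + 4 + q) \<in> F" using m t by metis
  have "R F th k (start f e + 4 + q) j \<noteq> None"
    by (rule present_any[OF ex' adm ty a k ke al q _ pr' m']) simp
  then obtain c where c: "R F th k (start f e + 4 + q) j = Some c" by blast
  have "\<not> (c = 0 \<and> \<not> fbad n f F e q j)"
    using late_zero_status[OF ex' pr' adm ty a j k ke al q m'] c by blast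
  moreover have "\<not> (c \<noteq> 0 \<and> fbad n f F e q j)"
  proof
    assume b: "c \<noteq> 0 \<and> fbad n f F e q j"
    then obtain w where w: "c = Suc w" by (cases c) auto
    show False
    proof (cases q)
      case 0
      show False by (rule forged_status[of e F th j k w]) (use ex' adm ty a j k ke al m' b c w 0 in simp_all)
    next
      case (Suc p)
      have e5: "start f e + 4 + q = start f e + 5 + p" "start f e + 3 + q = start f e + 4 + p" using Suc by simp_all
      show False
        by (rule switched_status[of e p F th j k w])
          (use ex' pr' adm ty a j k ke al m' b c w Suc q e5 in \<open>simp_all only: e5 Suc, simp_all\<close>)
    qed
  qed
  ultimately show "R F th k (Suc T) j = Some 0 \<longleftrightarrow> fbad n f F e q j" unfolding t c by auto
qed

lemma pres_0: "pres 0" and flag_0: "flag 0"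
  unfolding pres_def flag_def by auto

lemma exact: "exact T"
proof (induction T)
  case 0
  thus ?case unfolding exact_def using pres_0 flag_0 by simp
next
  case (Suc T)
  have "pres (Suc T)" by (rule pres_step[OF Suc])
  moreover have "flag (Suc T)" by (rule flag_step[OF Suc calculation])
  ultimately show ?case using Suc unfolding exact_def by (auto simp: le_Suc_eq)
qed

end

section \<open>Decisions of honest agents under full conformity\<close>

lemma act_mono: "act n f F e \<Longrightarrow> e' \<le> e \<Longrightarrow> act n f F e'"
  unfolding act_def by auto

lemma start_le_imp: "start f e' + 1 \<le> start f e + f + 4 \<Longrightarrow> e' \<le> e"
  using start_less[of e e' f] by (cases "e < e'") auto

lemma rcv_SomeD: "rcv n F Q k t j = Some m \<Longrightarrow> j < n \<and> (j, k, t) \<in> F"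
  unfolding rcv_def by (auto split: if_splits)

context deviation
begin

lemma proposal_of_top:
  assumes ex: "\<And>T. exact T" and adm: "admissible n f F" and ty: "types_ok n th" and a: "act n f F e"
    and eC: "e \<notin> C" and k: "k = e \<or> (e, k, start f e + 3) \<in> F"
  shows "fst (from_nat (proposal_of n f k (th k) (R F th k) e) :: 'v \<times> nat option list) = top_of (th e)"
proof (cases "k = e")
  case True
  thus ?thesis by (simp add: proposal_of_def proposal_def)
next
  case False
  hence ek: "(e, k, start f e + 3) \<in> F" using k by blast
  have fp: "fp_ok n F" using adm by (simp add: admissible_iff)
  note d = fp_okD[OF fp ek]
  have "running n f e (R F th e) e"
    by (rule sync_running[OF ex adm ty a d(1) eC alive_mono[OF d(4)] order_refl]) simp
  thus ?thesis using msg_proposal[OF eC, of F th k] d ek False by (simp add: proposal_of_def proposal_def)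
qed

text \<open>\<open>act\<close> and \<open>succ_ep\<close> single out one epoch, and all honest
  decisions belong to it: whoever survives an earlier epoch finds it failed, and whoever survives
  this one stops running.\<close>

lemma decision_time:
  assumes ex: "\<And>T. exact T" and adm: "admissible n f F" and ty: "types_ok n th" and a: "act n f F e"
    and su: "succ_ep n f F e" and k: "k < n" "k \<notin> C" and al: "alive n F k r" and d: "dout F th k r = Some d"
  shows "d = verdict F th k r e" "k = e \<or> (e, k, start f e + 3) \<in> F"
    "r = start f e + 3 \<and> k = e \<or> r = start f e + f + 4"
proof -
  obtain e' where e': "running n f k (R F th k) e'" "d = verdict F th k r e'"
    "r = start f e' + 3 \<and> k = e' \<or> r = start f e' + f + 4 \<and> \<not> lbad n f k (R F th k) e' (Suc f)"
    using d dout_iff[OF k(2)] by blast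
  have sy: "lbad n f k (R F th k) e'' (Suc f) \<longleftrightarrow> fbad n f F e'' (Suc f) k"
    if "act n f F e''" "start f e'' + f + 4 \<le> r" for e''
    by (rule sync_status[OF ex adm ty that(1) k order_refl alive_mono[OF al] order_refl]) (use that in simp)
  have "\<not> e' < e"
  proof
    assume lt: "e' < e"
    have ae': "act n f F e'" using act_mono[OF a] lt by simp
    show False
    proof (cases "r = start f e' + 3 \<and> k = e'")
      case True
      thus False using act_coord[OF a lt] al by simp
    next
      case False
      hence r: "r = start f e' + f + 4" "\<not> lbad n f k (R F th k) e' (Suc f)" using e' by blast+
      have "fbad n f F e' (Suc f) k" by (rule act_bad[OF adm a lt k(1)]) (use al r in simp)
      thus False using sy[OF ae'] r by simp
    qed
  qed
  moreover have "\<not> e < e'"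
  proof
    assume lt: "e < e'"
    hence "lbad n f k (R F th k) e (Suc f)" using e'(1) unfolding running_def by blast
    moreover have l: "start f e + f + 4 \<le> r" using start_less[OF lt, of f] e'(3) by auto
    ultimately have "fbad n f F e (Suc f) k" using sy[OF a] by blast
    thus False using su k(1) alive_mono[OF al l] unfolding succ_ep_def by blast
  qed
  ultimately have ee: "e' = e" by simp
  show "d = verdict F th k r e" using e' ee by simp
  show r: "r = start f e + 3 \<and> k = e \<or> r = start f e + f + 4" using e' ee by blast
  show "k = e \<or> (e, k, start f e + 3) \<in> F"
  proof (cases "k = e")
    case False
    hence "r = start f e + f + 4" using r by blast
    hence "\<not> fbad n f F e (Suc f) k" using su k(1) al unfolding succ_ep_def by blast
    thus ?thesis using fbad_mono[of n f F e 0 k "Suc f"] by auto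
  qed simp
qed

lemma decision_SomeD:
  assumes "decision n F (behaviour th) k = Some d"
  obtains r where "alive n F k r" "dout F th k r = Some d"
proof -
  have ex: "\<exists>r. decides_at n F (behaviour th) k r"
    by (rule ccontr) (use assms in \<open>simp add: decision_def\<close>)
  have "decides_at n F (behaviour th) k (LEAST r. decides_at n F (behaviour th) k r)"
    by (rule LeastI_ex[OF ex])
  moreover have "dout F th k (LEAST r. decides_at n F (behaviour th) k r) = Some d"
    using assms ex unfolding decision_def by simp
  ultimately show ?thesis using that unfolding decides_at_def by blast
qed

lemma decision_not_None:
  assumes "alive n F k r" "dout F th k r \<noteq> None"
  shows "decision n F (behaviour th) k \<noteq> None"
proof -
  have ex: "\<exists>r. decides_at n F (behaviour th) k r" using assms unfolding decides_at_def by blast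
  have "decides_at n F (behaviour th) k (LEAST r. decides_at n F (behaviour th) k r)"
    by (rule LeastI_ex[OF ex])
  thus ?thesis using ex unfolding decision_def decides_at_def by simp
qed

text \<open>The second alternative in \<open>al\<close> covers a coordinator that crashes after
  deciding; in \<open>deviator_decision\<close> it may be the only honest agent to decide.\<close>

lemma honest_decides:
  assumes ex: "\<And>T. exact T" and adm: "admissible n f F" and ty: "types_ok n th" and a: "act n f F e"
    and su: "succ_ep n f F e" and k: "k < n" "k \<notin> C"
    and al: "alive n F k (start f e + f + 4) \<or> k = e \<and> alive n F k (start f e + 3)"
  shows "decision n F (behaviour th) k \<noteq> None"
proof -
  have "alive n F k (start f e)" using al alive_mono by (metis add.assoc le_add1)
  hence r: "running n f k (R F th k) e" by (rule sync_running[OF ex adm ty a k _ order_refl])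
  show ?thesis
  proof (cases "alive n F k (start f e + f + 4)")
    case True
    have "lbad n f k (R F th k) e (Suc f) \<longleftrightarrow> fbad n f F e (Suc f) k"
      by (rule sync_status[OF ex adm ty a k order_refl alive_mono[OF True] order_refl]) simp
    hence "\<not> lbad n f k (R F th k) e (Suc f)" using su k(1) True unfolding succ_ep_def by blast
    hence "dout F th k (start f e + f + 4) \<noteq> None" using dout_iff[OF k(2)] r by blast
    thus ?thesis by (rule decision_not_None[OF True])
  next
    case False
    hence "k = e" "alive n F k (start f e + 3)" using al by blast+
    thus ?thesis using decision_not_None[of F k "start f e + 3" th] dout_iff[OF k(2)] r by blast
  qed
qed

lemma honest_decision:
  assumes ex: "\<And>T. exact T" and adm: "admissible n f F" and ty: "types_ok n th" and a: "act n f F e"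
    and su: "succ_ep n f F e" and eC: "e \<notin> C" and k: "k < n" "k \<notin> C"
    and d: "decision n F (behaviour th) k = Some d" and nt: "d \<noteq> Top"
  shows "d = Val (top_of (th e))"
proof -
  obtain r where r: "alive n F k r" "dout F th k r = Some d" by (rule decision_SomeD[OF d])
  note t = decision_time[OF ex adm ty a su k r]
  show ?thesis using t(1) nt proposal_of_top[OF ex adm ty a eC t(2)] unfolding verdict_def by (auto split: if_splits)
qed

end

section \<open>Runs without deviation\<close>

lemma deviate_empty: "deviate s {} s' = honest s"
  unfolding deviate_def honest_def by simp

text \<open>Without colluders \<open>pres\<close> and \<open>flag\<close> hold vacuously, so the
  results on deviations also describe the protocol itself.\<close>

locale honest_run = deviation n f "{}" s' for n f and s' :: "'v::finite jprofile" +
  assumes fn: "f + 2 \<le> n"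
begin

lemma ex: "exact T"
  unfolding exact_def pres_def flag_def by simp

text \<open>Soundness of the alarms. The bound on \<open>r\<close> matters: after a successful epoch
  the agents fall silent, which would look like a crash.\<close>

lemma no_alarm:
  assumes adm: "admissible n f F" and ty: "types_ok n th" and a: "act n f F e" and k: "k < n"
    and al: "alive n F k r" and r: "r = start f e + 3 \<and> k = e \<or> r = start f e + f + 4 \<and> k \<noteq> e"
  shows "\<not> alarm n f k (th k) (H F th r k) r"
proof -
  have fp: "fp_ok n F" using adm by (simp add: admissible_iff)
  have ae: "act n f F e'" if "start f e' + 1 \<le> r" for e'
    by (rule act_mono[OF a start_le_imp]) (use that r in auto)
  have lt: "e' < n" if "start f e' + 1 \<le> r" for e'
    using act_le[OF adm fn ae[OF that]] fn by simp
  have run: "running n f y (R F th y) e'" if "start f e' + 1 \<le> r" "y < n" "alive n F y (start f e')" for e' y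
    by (rule sync_running[OF ex adm ty ae[OF that(1)] that(2) _ that(3) order_refl]) simp
  have st: "lbad n f y (R F th y) e' q \<longleftrightarrow> fbad n f F e' q y"
    if "start f e' + 1 \<le> r" "y < n" "q \<le> Suc f" "alive n F y (start f e' + 3 + q)" for e' y q
    by (rule sync_status[OF ex adm ty ae[OF that(1)] that(2) _ that(3,4) order_refl]) simp
  have fl: "R F th k (start f e' + 4 + q) y = Some 0 \<longleftrightarrow> fbad n f F e' q y"
    if "start f e' + 4 + q \<le> r" "q \<le> f" "k \<noteq> e'" "(y, k, start f e' + 4 + q) \<in> F" for e' q y
    by (rule flag_any[OF ex adm ty ae _ that(3) alive_mono[OF al] that(2) order_refl that(4)]) (use that in auto)
  have "suspects n f (H F th r k) r \<subseteq> faulty n F"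
  proof
    fix j assume "j \<in> suspects n f (H F th r k) r"
    then obtain e' where jn: "j < n" and c: "start f e' + 1 \<le> r \<and> R F th k (start f e' + 1) j = None \<or>
      start f e' + 3 \<le> r \<and> j = e' \<and> R F th k (start f e' + 3) j = None \<or>
      (\<exists>q\<le>f. start f e' + 4 + q \<le> r \<and> R F th k (start f e' + 4 + q) j = None)"
      unfolding suspects_H by blast
    have s1: "start f e' + 1 \<le> r" using c by auto
    have rj: "running n f j (R F th j) e'" if "(j, k, t) \<in> F" "start f e' + 1 \<le> t" for t
      by (rule run[OF s1 jn alive_mono[OF fp_okD(4)[OF fp that(1)]]]) (use that in simp)
    consider "R F th k (start f e' + 1) j = None" | "j = e'" "R F th k (start f e' + 3) j = None"
      | q where "q \<le> f" "R F th k (start f e' + 4 + q) j = None" using c by (elim disjE exE conjE)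
    thus "j \<in> faulty n F"
    proof cases
      case 1
      have "(j, k, start f e' + 1) \<notin> F"
        using msg_ping[OF _ rj, of "start f e' + 1" k] 1 jn by auto
      thus ?thesis by (rule undelivered_faulty[OF jn k, rotated]) simp
    next
      case 2
      have "(j, k, start f e' + 3) \<notin> F"
        using msg_proposal[of j F th k] rj[of "start f e' + 3"] 2 jn by auto
      thus ?thesis by (rule undelivered_faulty[OF jn k, rotated]) simp
    next
      case 3
      have "(j, k, start f e' + 4 + q) \<notin> F"
        using msg_status[OF _ rj 3(1), of "start f e' + 4 + q" k] 3 jn by auto
      thus ?thesis by (rule undelivered_faulty[OF jn k, rotated]) simp
    qed
  qed
  hence 1: "\<not> f < card (suspects n f (H F th r k) r)"
    using faulty_card_le[OF adm] by (simp add: not_less)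
  have 2: "\<not> forged n f k (th k) (H F th r k) e' j w" for e' j w
  proof
    assume fo: "forged n f k (th k) (H F th r k) e' j w"
    have ne: "e' \<noteq> k" and jn: "j < n" and hj: "H F th r k (start f e' + 4) j = Some (Suc w)"
      using fo unfolding forged_def by blast+
    have r4: "start f e' + 4 \<le> r" and rj: "R F th k (start f e' + 4) j = Some (Suc w)"
      using hist_at_SomeD[OF hj] by auto
    have s1: "start f e' + 1 \<le> r" using r4 by simp
    have jk: "(j, k, start f e' + 4) \<in> F" using rcv_SomeD[OF rj] by blast
    have aj: "alive n F j (start f e' + 3)" using fp_okD(4)[OF fp jk] by (simp add: add.commute)
    have run_j: "running n f j (R F th j) e'" by (rule run[OF s1 jn alive_mono[OF aj]]) simp
    have sj: "status n f j (th j) (R F th j) e' 0 = Suc w"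
      using msg_status[OF _ run_j, of 0 k] rj jn jk by simp
    hence nb: "\<not> lbad n f j (R F th j) e' 0" and w: "w = proposal_of n f j (th j) (R F th j) e'"
      unfolding status_def by (auto split: if_splits)
    have ej: "j = e' \<or> (e', j, start f e' + 3) \<in> F" using st[OF s1 jn, of 0] nb aj by simp
    have ae2: "alive n F e' (start f e' + 2)"
      using ej aj alive_mono[OF aj, of "start f e' + 2"] fp_okD(4)[OF fp, of e' j "start f e' + 3"] by (auto simp: add.commute)
    have run_e: "running n f e' (R F th e') e'" by (rule run[OF s1 lt[OF s1] alive_mono[OF ae2]]) simp
    have run_k: "running n f k (R F th k) e'" by (rule run[OF s1 k alive_mono[OF al]]) (use s1 in simp)
    have we: "w = proposal n f (th e') (R F th e') e'"
    proof (cases "j = e'")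
      case True
      thus ?thesis using w by (simp add: proposal_of_def)
    next
      case False
      thus ?thesis using w ej msg_proposal[OF _ run_e, of j] lt[OF s1] by (simp add: proposal_of_def)
    qed
    have "H F th r k (start f e' + 1) e' = Some 0"
      using msg_ping[OF _ run_e, of k] aliveD[OF ae2 k, of "start f e' + 1"] lt[OF s1] s1 by (simp add: hist_at_le)
    moreover have "snd (from_nat w :: 'v \<times> nat option list) ! k = Some (report n f (th k) (H F th r k) e')"
    proof -
      have "R F th e' (start f e' + 2) k = Some (report n f (th k) (R F th k) e')"
        using msg_report[OF _ run_k] k aliveD[OF al lt[OF s1], of "start f e' + 2"] r4 by simp
      moreover have "report n f (th k) (H F th r k) e' = report n f (th k) (R F th k) e'"
        by (rule report_cong, rule hist_at_le[OF s1])
      ultimately show ?thesis unfolding we proposal_def using k by simp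
    qed
    moreover have "w' = w" if "H F th r k (start f e' + 3) e' = Some w'" for w'
    proof -
      have x: "R F th k (start f e' + 3) e' = Some w'" using hist_at_SomeD[OF that] by blast
      show ?thesis using msg_proposal[OF _ run_e, of k] x rcv_SomeD[OF x] we by simp
    qed
    ultimately show False using fo unfolding forged_def by auto
  qed
  have 3: "\<not> late n f k (H F th r k) e' j q" for e' j q
  proof
    assume "late n f k (H F th r k) e' j q"
    hence ne: "e' \<noteq> k" and jn: "j < n" and q: "q \<le> f" and h: "H F th r k (start f e' + 4) e' \<noteq> None"
      "H F th r k (start f e' + 4 + q) j = Some 0" unfolding late_def by blast+
    obtain m where "H F th r k (start f e' + 4) e' = Some m" using h by blast
    hence ek: "(e', k, start f e' + 4) \<in> F" using hist_at_SomeD rcv_SomeD by blast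
    have ae3: "alive n F e' (start f e' + 3)" using fp_okD(4)[OF fp ek] by (simp add: add.commute)
    have x: "R F th k (start f e' + 4 + q) j = Some 0" "start f e' + 4 + q \<le> r"
      using hist_at_SomeD[OF h(2)] by blast+
    have "fbad n f F e' q j" using fl[OF x(2) q ne[symmetric]] rcv_SomeD[OF x(1)] x(1) by blast
    thus False using fbad_none[of n e' f F j q] aliveD[OF ae3] jn by simp
  qed
  have 4: "\<not> switched n f k (H F th r k) e' j y q w" for e' j y q w
  proof
    assume "switched n f k (H F th r k) e' j y q w"
    hence ne: "e' \<noteq> k" and jn: "j < n" and yn: "y < n" and q: "q < f" and h: "H F th r k (start f e' + 4 + q) y = Some 0"
      "H F th r k (start f e' + 5 + q) y \<noteq> None" "H F th r k (start f e' + 5 + q) j = Some (Suc w)"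
      unfolding switched_def by blast+
    have t5: "start f e' + 5 + q = start f e' + 4 + Suc q" "start f e' + 5 + q - 1 = start f e' + 4 + q" by simp_all
    have x: "R F th k (start f e' + 4 + q) y = Some 0" "start f e' + 4 + q \<le> r"
      using hist_at_SomeD[OF h(1)] by blast+
    have b: "fbad n f F e' q y" using fl[OF x(2) _ ne[symmetric]] rcv_SomeD[OF x(1)] x(1) q by simp
    obtain m where "H F th r k (start f e' + 5 + q) y = Some m" using h by blast
    hence "(y, k, start f e' + 5 + q) \<in> F" using hist_at_SomeD rcv_SomeD by blast
    hence ay: "alive n F y (start f e' + 4 + q)" using fp_okD(4)[OF fp] unfolding t5(2)[symmetric] by blast
    have z: "R F th k (start f e' + 5 + q) j = Some (Suc w)" "start f e' + 5 + q \<le> r"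
      using hist_at_SomeD[OF h(3)] by blast+
    have jd: "(j, k, start f e' + 5 + q) \<in> F" using rcv_SomeD[OF z(1)] by blast
    show False
    \<comment> \<open>A coordinator that still speaks has completed its broadcast, so
      \<open>y\<close> cannot be bad; any other \<open>j\<close> was informed by \<open>y\<close>
      and is bad itself.\<close>
    proof (cases "j = e'")
      case True
      have "alive n F e' (start f e' + 4 + q)" using fp_okD(4)[OF fp jd] True unfolding t5(2) by simp
      hence "(e', v, start f e' + 3) \<in> F" if "v < n" for v using aliveD[of n F e' _ v] that by simp
      thus False using fbad_none[of n e' f F y q] yn b by blast
    next
      case False
      have "(y, j, start f e' + 4 + q) \<in> F" by (rule aliveD[OF ay jn]) simp_all
      hence "fbad n f F e' (Suc q) j" using b yn False by auto
      hence "R F th k (start f e' + 5 + q) j = Some 0"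
        using fl[of e' "Suc q" j] z(2) q ne jd unfolding t5(1) by simp
      thus False using z(1) by simp
    qed
  qed
  show ?thesis unfolding alarm_def using 1 2 3 4 by blast
qed

lemma honest_outcome:
  assumes adm: "admissible n f F" and ty: "types_ok n th" and a: "act n f F e" and su: "succ_ep n f F e" and k: "k < n"
    and d: "decision n F (behaviour th) k = Some d"
  shows "d = Val (top_of (th e))"
proof -
  have kC: "k \<notin> {}" and eC: "e \<notin> {}" by simp_all
  define P where "P = (\<lambda>r. decides_at n F (behaviour th) k r)"
  define r where "r = (LEAST r. P r)"
  have Pe: "\<exists>r. P r"
    by (rule ccontr) (use d in \<open>simp add: decision_def P_def\<close>)
  have Pr: "P r" unfolding r_def by (rule LeastI_ex[OF Pe])
  hence alr: "alive n F k r" unfolding P_def decides_at_def by blast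
  have dr: "dout F th k r = Some d"
    using d Pe unfolding decision_def r_def P_def by simp
  note t = decision_time[OF ex adm ty a su k kC alr dr]
  \<comment> \<open>A surviving coordinator outputs a decision twice, after its broadcast and at the
    end of the epoch; only the first one counts.\<close>
  have "r = start f e + 3 \<and> k = e \<or> r = start f e + f + 4 \<and> k \<noteq> e"
  proof (cases "k = e")
    case True
    have ak: "alive n F k (start f e + 3)" using t(3) alive_mono[OF alr] by auto
    have "running n f k (R F th k) e" by (rule sync_running[OF ex adm ty a k kC alive_mono[OF ak] order_refl]) simp
    hence "dout F th k (start f e + 3) \<noteq> None" using dout_iff[OF kC] True by blast
    hence "P (start f e + 3)" unfolding P_def decides_at_def using ak by blast
    hence "r \<le> start f e + 3" unfolding r_def by (rule Least_le)
    thus ?thesis using t(3) True by auto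
  qed (use t(3) in blast)
  hence "\<not> alarm n f k (th k) (H F th r k) r" by (rule no_alarm[OF adm ty a k alr])
  thus ?thesis using t(1) proposal_of_top[OF ex adm ty a eC t(2)] unfolding verdict_def by simp
qed

lemma honest_consensus:
  assumes adm: "admissible n f F" and ty: "types_ok n th"
  shows "consensus_run n F th (behaviour th)"
proof -
  obtain e where e: "e \<le> f" "succ_ep n f F e" "act n f F e" by (rule ex_succ_ep[OF adm fn])
  have en: "e < n" using e fn by simp
  note out = honest_outcome[OF adm ty e(3,2)]
  have "decision n F (behaviour th) i \<noteq> None" if "i < n" "correct n F i" for i
    by (rule honest_decides[OF ex adm ty e(3,2) that(1)]) (use that in \<open>simp_all add: correct_iff_alive\<close>)
  moreover have "most_pref (th e) (top_of (th e))"
    using most_pref_iff_top_of[of "th e"] ty en unfolding types_ok_def by blast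
  ultimately show ?thesis unfolding consensus_run_def using out en by blast
qed

end

section \<open>Decisions of the colluders and resilience\<close>

context legal_deviation
begin

text \<open>A single honest decision suffices: legality rules out \<open>Top\<close>, conformity
  then fixes the value, and uniform agreement transfers it to \<open>i\<close>.\<close>

lemma witnessed_decision:
  assumes adm: "admissible n f F" and ty: "types_ok n th" and a: "act n f F e"
    and su: "succ_ep n f F e" and eC: "e \<notin> C" and k: "k < n" "k \<notin> C"
    and al: "alive n F k (start f e + f + 4) \<or> k = e \<and> alive n F k (start f e + 3)"
    and i: "i < n" "correct n F i"
  shows "decision n F (behaviour th) i = Some (Val (top_of (th e)))"
proof -
  have cr: "consensus_run n F th (behaviour th)" by (rule consensus[OF adm ty])
  obtain d where d: "decision n F (behaviour th) k = Some d"
    using honest_decides[OF exact adm ty a su k al] by blast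
  hence "d \<noteq> Top" using cr k unfolding consensus_run_def by blast
  from honest_decision[OF exact adm ty a su eC k d this] d
  have dk: "decision n F (behaviour th) k = Some (Val (top_of (th e)))" by simp
  obtain b where b: "decision n F (behaviour th) i = Some b" using cr i unfolding consensus_run_def by blast
  hence "b = Val (top_of (th e))" using cr i k dk unfolding consensus_run_def by blast
  thus ?thesis using b by simp
qed

text \<open>If no honest agent survives the epoch, the colluders cannot tell whether the
  coordinator decided before it crashed.\<close>

lemma deviator_decision:
  assumes adm: "admissible n f F" and ty: "types_ok n th" and a: "act n f F e"
    and su: "succ_ep n f F e" and eC: "e \<notin> C" and i: "i < n" "i \<in> C" "correct n F i"
  shows "decision n F (behaviour th) i = Some (Val (top_of (th e)))"
proof (cases "\<exists>k<n. k \<notin> C \<and> alive n F k (start f e + f + 4)")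
  case True
  then obtain k where "k < n" "k \<notin> C" "alive n F k (start f e + f + 4)" by blast
  thus ?thesis using witnessed_decision[OF adm ty a su eC _ _ _ i(1,3)] by blast
next
  case False
  let ?s = "start f e"
  have fp: "fp_ok n F" using adm by (simp add: admissible_iff)
  have en: "e < n" using act_le[OF adm fn a] fn by simp
  have ali: "alive n F i r" for r using i(3) unfolding correct_iff_alive by blast
  have good: "\<not> fbad n f F e q x" if "q \<le> Suc f" "x < n" "alive n F x (?s + f + 4)" for q x
    using su that fbad_mono[of n f F e q x "Suc f"] unfolding succ_ep_def by blast
  have ei: "(e, i, ?s + 3) \<in> F" using good[of 0 i] ali i eC by auto
  have ae: "alive n F e (?s + 2)" using fp_okD(4)[OF fp ei] by simp
  \<comment> \<open>All survivors of the epoch are colluders and not bad, so completing the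
    broadcast changes nothing for them. In \<open>F'\<close> the honest \<open>e\<close> lives long
    enough to decide and serves as the witness.\<close>
  define F' where "F' = F \<union> {(e, x, ?s + 3) | x. x < n}"
  have FG: "F \<subseteq> F'" unfolding F'_def by blast
  have fp': "fp_ok n F'"
  proof (rule fp_okI)
    fix y x r assume h: "(y, x, r) \<in> F'"
    show "y < n \<and> x < n \<and> 1 \<le> r \<and> alive n F' y (r - 1)"
    proof (cases "(y, x, r) \<in> F")
      case True
      thus ?thesis using fp_okD[OF fp True] alive_superset[OF _ FG] by blast
    next
      case False
      hence "y = e" "x < n" "r = ?s + 3" using h unfolding F'_def by auto
      thus ?thesis using en alive_superset[OF ae FG] by simp
    qed
  qed
  have adm': "admissible n f F'"
    by (rule admissibleI[OF fp' faulty_mono[OF FG]]) (use adm in \<open>simp_all add: admissible_iff\<close>)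
  have sm: "(y, x, r) \<in> F' \<longleftrightarrow> (y, x, r) \<in> F" if "r \<noteq> ?s + 3 \<or> y \<noteq> e" for y x r
    using that unfolding F'_def by auto
  have a': "act n f F' e" using a act_cong[of f e F F' n] sm by auto
  have de: "(e, x, ?s + 3) \<in> F'" if "x < n" for x using that unfolding F'_def by simp
  have su': "succ_ep n f F' e" unfolding succ_ep_def using fbad_none[OF de] by blast
  have ali': "alive n F' i r" for r by (rule alive_superset[OF ali FG])
  have s3: "Suc (?s + 2) = ?s + 3" by simp
  have ae': "alive n F' e (?s + 3)"
    using alive_extend[OF alive_superset[OF ae FG]] de unfolding s3 by blast
  have fe: "H F' th (?s + 3 + q) x = H F th (?s + 3 + q) x"
    if "q \<le> Suc f" "x \<in> C" "x < n" "alive n F x (?s + f + 4)" for q x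
  proof (rule flood_eq[OF exact adm adm' ty a _ _ de])
    show "alive n F x (?s + 3 + q)" by (rule alive_mono[OF that(4)]) (use that(1) in simp)
    show "\<not> fbad n f F e q x" by (rule good[OF that(1,3,4)])
  qed (use sm that in auto)
  \<comment> \<open>After the epoch only its survivors can be heard, and their histories agree
    already.\<close>
  have late: "H F' th (?s + f + 4 + t) x = H F th (?s + f + 4 + t) x"
    if "x < n" "alive n F x (?s + f + 4 + t)" for t x
    using that
  proof (induction t arbitrary: x)
    case 0
    have "x \<in> C" using False 0 by auto
    thus ?case using fe[of "Suc f" x] 0 by (simp add: eval_nat_numeral)
  next
    case (Suc t)
    have "H F' th (Suc (?s + f + 4 + t)) x = H F th (Suc (?s + f + 4 + t)) x"
    proof (rule hist_at_eqI)
      show "H F' th (?s + f + 4 + t) x = H F th (?s + f + 4 + t) x"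
        by (rule Suc.IH[OF Suc.prems(1) alive_mono[OF Suc.prems(2)]]) simp
      fix y assume y: "y < n"
      have same: "(y, x, Suc (?s + f + 4 + t)) \<in> F' \<longleftrightarrow> (y, x, Suc (?s + f + 4 + t)) \<in> F"
        by (rule sm) simp
      have "H F' th (?s + f + 4 + t) y = H F th (?s + f + 4 + t) y" if "(y, x, Suc (?s + f + 4 + t)) \<in> F"
        by (rule Suc.IH[OF y fp_okD(4)[OF fp that, unfolded diff_Suc_1]])
      thus "R F' th x (Suc (?s + f + 4 + t)) y = R F th x (Suc (?s + f + 4 + t)) y"
        unfolding rcv_def diff_Suc_1 same by auto
    qed
    thus ?case by simp
  qed
  have "H F' th r i = H F th r i" for r
  proof -
    consider "r \<le> ?s + 2" | q where "q \<le> Suc f" "r = ?s + 3 + q" | t where "r = ?s + f + 4 + t"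
    proof -
      have "r \<le> ?s + 2 \<or> (r - (?s + 3) \<le> Suc f \<and> r = ?s + 3 + (r - (?s + 3))) \<or> r = ?s + f + 4 + (r - (?s + f + 4))"
        by linarith
      thus ?thesis using that by blast
    qed
    thus ?thesis
    proof cases
      case 1
      show ?thesis by (rule hist_at_rounds_cong) (use sm 1 in auto)
    next
      case 2
      show ?thesis unfolding 2(2) by (rule fe[OF 2(1) i(2,1) ali])
    next
      case 3
      show ?thesis unfolding 3 by (rule late[OF i(1) ali])
    qed
  qed
  hence do: "dout F' th i = dout F th i" unfolding dec_out_def by presburger
  have deq: "decides_at n F' (behaviour th) i = decides_at n F (behaviour th) i"
    unfolding decides_at_def do using ali ali' by (simp add: fun_eq_iff)
  have "decision n F' (behaviour th) i = decision n F (behaviour th) i"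
    unfolding decision_def do deq ..
  moreover have "correct n F' i" using ali' unfolding correct_iff_alive by blast
  ultimately show ?thesis
    using witnessed_decision[OF adm' ty a' su' eC en eC _ i(1)] ae' by simp
qed

end

theorem theorem2:
  fixes n f :: nat
  assumes "card (UNIV :: 'v set) \<ge> 3"
    and "f + 2 \<le> n"
  shows "\<exists>s :: ('v::finite) protocol. resilient_consensus n 2 f s"
proof
  let ?s = "prot n f :: 'v protocol"
  interpret h: honest_run n f "honest ?s" by unfold_locales (rule assms(2))
  have hb: "h.behaviour th = (\<lambda>i. honest ?s i th)" for th by (simp add: deviate_empty)
  have "\<not> can_manipulate u n f ?s C" if u: "valid_util u" and C: "C \<subseteq> {..<n}" "card C \<le> 2" for u C
  proof
    assume "can_manipulate u n f ?s C"
    then obtain s' :: "'v jprofile" and F th v i where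
      ind: "\<forall>i\<in>C. \<forall>th th'. (\<forall>j\<in>C. th j = th' j) \<longrightarrow> s' i th = s' i th'"
      and leg: "legal n f (deviate ?s C s')" and adm: "admissible n f F" and ty: "types_ok n th"
      and v: "\<forall>i\<in>C. most_pref (th i) v" and i: "i \<in> C"
      and gain: "utility u n F th (honest ?s) i < utility u n F th (deviate ?s C s') i"
      unfolding can_manipulate_def by blast
    interpret d: legal_deviation n f C s'
      by unfold_locales (use assms leg ind C in auto)
    have c: "correct n F i" using gain unfolding utility_def by (auto split: if_splits)
    have iN: "i < n" using i C by auto
    \<comment> \<open>This choice depends on \<open>F\<close> alone, so it serves the honest and the
      deviating profile alike.\<close>
    obtain e where e: "succ_ep n f F e" "act n f F e" by (rule ex_succ_ep[OF adm assms(2)])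
    have cd: "consensus_run n F th (d.behaviour th)" by (rule d.consensus[OF adm ty])
    have ch: "consensus_run n F th (h.behaviour th)" by (rule h.honest_consensus[OF adm ty])
    have "decision n F (h.behaviour th) i \<noteq> None" using ch iN c unfolding consensus_run_def by blast
    hence dh: "decision n F (h.behaviour th) i = Some (Val (top_of (th e)))"
      using h.honest_outcome[OF adm ty e(2,1) iN] by auto
    have "decision n F (d.behaviour th) i \<noteq> None" using cd iN c unfolding consensus_run_def by blast
    then obtain x where dd: "decision n F (d.behaviour th) i = Some (Val x)"
      using cd iN unfolding consensus_run_def by blast
    have less: "u i (th i) (top_of (th e)) < u i (th i) x"
      using gain c cd ch[unfolded hb] dh[unfolded hb] dd unfolding utility_def by simp
    show False
    proof (cases "e \<in> C")
      case False
      have "x = top_of (th e)" using d.deviator_decision[OF adm ty e(2,1) False iN i c] dd by simp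
      thus False using less by simp
    next
      case True
      have ti: "is_type (th i)" "is_type (th e)" using ty iN True C unfolding types_ok_def by auto
      have "v = top_of (th e)" using v True most_pref_iff_top_of[OF ti(2)] by blast
      hence "most_pref (th i) (top_of (th e))" using v i by blast
      hence "x = top_of (th e) \<or> (top_of (th e), x) \<in> th i" unfolding most_pref_def by blast
      moreover have "u i (th i) x < u i (th i) (top_of (th e))" if "(top_of (th e), x) \<in> th i"
        using u ti(1) that unfolding valid_util_def by blast
      ultimately show False using less by auto
    qed
  qed
  moreover have "legal n f (honest ?s)"
    unfolding legal_def using h.honest_consensus unfolding hb by blast
  ultimately show "resilient_consensus n 2 f ?s" unfolding resilient_consensus_def by blast
qed

end
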